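(* Let $\varphi:\mathbb{R}^n\to\mathbb{R}$ be of class $C^{1,1}$, and let $\{x^k\}$ be the sequence generated by Algorithm GRNM-WM (described in the context) from the starting point $x^0\in\mathbb{R}^n$. Suppose that the set $\Omega=\{x\in\mathbb{R}^n\mid\varphi(x)\le\varphi(x^0)\}$ is bounded. Then Algorithm GRNM-WM is well-defined and exhibits the following convergence properties: (i) If $\varphi$ is a KL function, then $\sum_{k=0}^\infty\|x^{k+1}-x^k\|<\infty$. In particular, $\{x^k\}$ converges to a stationary point $\bar x$ as $k\to\infty$. (ii) If $\varphi$ is a KL function of exponent $\theta\in(0,1)$, then $\{x^k\}$ converges to $\bar x$ with the rates: (a) When $\theta\in(0,\frac12)$, for any $\epsilon>0$ and any large $k\in\mathbb{N}$ we have $\|x^{k+1}-\bar x\|\le\epsilon\|x^k-\bar x\|^{\frac{1}{2\theta}}$. If furthermore $\bar x$ is a local minimizer of $\varphi$, then there is no function $\varphi$ of class $C^{1,1}$ satisfying the KL property at $\bar x$ with such an exponent. (b) When $\theta=\frac12$, there exist $\gamma>0$ and $q\in(0,1)$ such that for all large $k\in\mathbb{N}$ we have $\|x^k-\bar x\|\le\sum_{j=k}^\infty\|x^{j+1}-x^j\|\le\gamma q^k$. (c) When $\theta\in(\frac12,1)$, there exists $\gamma>0$ such that $\|x^k-\bar x\|\le\sum_{j=k}^\infty\|x^{j+1}-x^j\|\le\gamma k^{\frac{1-\theta}{1-2\theta}}$.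
   Context: A function is of class $C^{1,1}$ if it is continuously differentiable with locally Lipschitz gradient. For a set $\Omega\subset\mathbb{R}^s$ and $\bar z\in\Omega$, the regular normal cone is $\widehat N_\Omega(\bar z)=\{v\mid \limsup_{z\to\bar z,\,z\in\Omega}\langle v,z-\bar z\rangle/\|z-\bar z\|\le 0\}$, and the limiting normal cone $N_\Omega(\bar z)$ is the set of all $v$ for which there are $z_k\to\bar z$ with $z_k\in\Omega$, and $v_k\to v$ with $v_k\in\widehat N_\Omega(z_k)$. For $\varphi$ of class $C^{1,1}$, the generalized Hessian at $x$ is $\partial^2\varphi(x)(u)=\{z\mid (z,-u)\in N_{\mathrm{gph}\,\nabla\varphi}(x,\nabla\varphi(x))\}$, $u\in\mathbb{R}^n$. KL property (for a $C^1$ function $\varphi:\mathbb{R}^n\to\mathbb{R}$): $\varphi$ has the basic KL property at $\bar x$ if there exist $\eta\in(0,\infty]$, a neighborhood $U$ of $\bar x$ and a function $\psi:[0,\eta)\to[0,\infty)$ which is concave and $C^1$-smooth on $(0,\eta)$ with $\psi(0)=0$ and $\psi'(s)>0$ on $(0,\eta)$, such that $\psi'(\varphi(x)-\varphi(\bar x))\,\|\nabla\varphi(x)\|\ge1$ for all $x\in U$ with $\varphi(\bar x)<\varphi(x)<\varphi(\bar x)+\eta$. If $\psi$ can be chosen as $\psi(s)=Cs^{1-\theta}$ with $\theta\in[0,1)$ for some $C>0$, then $\varphi$ has the KL property at $\bar x$ with exponent $\theta$. $\varphi$ is a KL function (of exponent $\theta$) if it has the basic KL property (with exponent $\theta$,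 respectively) at every point. Algorithm GRNM-WM. Input: $x^0\in\mathbb{R}^n$, $c>0$ (listed as an input but not used below), $0<\sigma_1<\sigma_2<1$, $M>m>0$. For $k=0,1,\ldots$: (1) If $\nabla\varphi(x^k)=0$, stop; otherwise go to the next step. (2) Choose $\mu_k\ge0$ in such a way that there exists $d^k\in\mathbb{R}^n$ with $-\nabla\varphi(x^k)\in\partial^2\varphi(x^k)(d^k)+\mu_kd^k$, $m\|d^k\|^2\le\langle-\nabla\varphi(x^k),d^k\rangle$ and $\|\nabla\varphi(x^k)\|\le M\|d^k\|$. (3) Set $\tau_k=1$ and check the Wolfe conditions $$\varphi(x^k+\tau_kd^k)\le\varphi(x^k)+\sigma_1\tau_k\langle\nabla\varphi(x^k),d^k\rangle,\qquad \langle\nabla\varphi(x^k+\tau_kd^k),d^k\rangle\ge\sigma_2\langle\nabla\varphi(x^k),d^k\rangle.$$ If they do not hold, adjust $\tau_k$ until it satisfies them. It is assumed that in the implementation there is an upper bound $\tau_{\max}$ on the maximum stepsize allowed. (4) Set $x^{k+1}=x^k+\tau_kd^k$. The algorithm being well-defined refers to the existence, for any $k\in\mathbb{N}$, of $\mu_k$ such that the inclusion in step (2) is solvable and the conditions required there are satisfied.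
   Formalization: Well-definedness is proved for each m>0 and all M above a threshold depending on the data, since it fails for arbitrary M>m (e.g. φ(x)=x², m=1/2, M=1); the "no function" clause in (a) is read under the hypotheses of (ii), as it fails for locally constant functions. *)

theory Defs
  imports "HOL-Analysis.Analysis"
begin

definition grad :: "('a::euclidean_space \<Rightarrow> real) \<Rightarrow> 'a \<Rightarrow> 'a" where
  "grad \<phi> x = (THE g. GDERIV \<phi> x :> g)"

definition class_C11 :: "('a::euclidean_space \<Rightarrow> real) \<Rightarrow> bool" where
  "class_C11 \<phi> \<longleftrightarrow>
     (\<forall>x. \<phi> differentiable (at x)) \<and>
     continuous_on UNIV (grad \<phi>) \<and>
     (\<forall>x. \<exists>r>0. \<exists>L. L-lipschitz_on (ball x r) (grad \<phi>))"

definition local_minimizer :: "('a::euclidean_space \<Rightarrow> real) \<Rightarrow> 'a \<Rightarrow> bool" where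
  "local_minimizer \<phi> x \<longleftrightarrow> (\<forall>\<^sub>F y in nhds x. \<phi> x \<le> \<phi> y)"


text \<open>The filter \<^term>\<open>at z within \<Omega>\<close> excludes \<^term>\<open>z\<close> itself, and the upper limit is taken in
  \<^typ>\<open>ereal\<close>; at an isolated point of \<open>\<Omega>\<close> it is \<open>-\<infinity>\<close>, so that every vector is a regular normal.\<close>

definition regular_normal_cone :: "'a::euclidean_space set \<Rightarrow> 'a \<Rightarrow> 'a set" where
  "regular_normal_cone \<Omega> z =
     {v. Limsup (at z within \<Omega>) (\<lambda>y. ereal (v \<bullet> (y - z) / norm (y - z))) \<le> 0}"

definition limiting_normal_cone :: "'a::euclidean_space set \<Rightarrow> 'a \<Rightarrow> 'a set" where
  "limiting_normal_cone \<Omega> z =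
     {v. \<exists>zs vs. (\<forall>k::nat. zs k \<in> \<Omega> \<and> vs k \<in> regular_normal_cone \<Omega> (zs k)) \<and>
                 zs \<longlonglongrightarrow> z \<and> vs \<longlonglongrightarrow> v}"

definition gen_hessian :: "('a::euclidean_space \<Rightarrow> real) \<Rightarrow> 'a \<Rightarrow> 'a \<Rightarrow> 'a set" where
  "gen_hessian \<phi> x u =
     {z. (z, - u) \<in> limiting_normal_cone {(y, grad \<phi> y) | y. True} (x, grad \<phi> x)}"


definition desingularizing :: "ereal \<Rightarrow> (real \<Rightarrow> real) \<Rightarrow> bool" where
  "desingularizing \<eta> \<psi> \<longleftrightarrow>
     (\<forall>s. 0 \<le> s \<and> ereal s < \<eta> \<longrightarrow> 0 \<le> \<psi> s) \<and>
     concave_on {s. 0 < s \<and> ereal s < \<eta>} \<psi> \<and>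
     \<psi> differentiable_on {s. 0 < s \<and> ereal s < \<eta>} \<and>
     continuous_on {s. 0 < s \<and> ereal s < \<eta>} (deriv \<psi>) \<and>
     \<psi> 0 = 0 \<and>
     (\<forall>s. 0 < s \<and> ereal s < \<eta> \<longrightarrow> deriv \<psi> s > 0)"

definition KL_with ::
  "('a::euclidean_space \<Rightarrow> real) \<Rightarrow> 'a \<Rightarrow> ereal \<Rightarrow> 'a set \<Rightarrow> (real \<Rightarrow> real) \<Rightarrow> bool" where
  "KL_with \<phi> x\<^sub>0 \<eta> U \<psi> \<longleftrightarrow>
     0 < \<eta> \<and> open U \<and> x\<^sub>0 \<in> U \<and> desingularizing \<eta> \<psi> \<and>
     (\<forall>x\<in>U. \<phi> x\<^sub>0 < \<phi> x \<and> ereal (\<phi> x) < ereal (\<phi> x\<^sub>0) + \<eta> \<longrightarrow>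
        deriv \<psi> (\<phi> x - \<phi> x\<^sub>0) * norm (grad \<phi> x) \<ge> 1)"

definition KL_at :: "('a::euclidean_space \<Rightarrow> real) \<Rightarrow> 'a \<Rightarrow> bool" where
  "KL_at \<phi> x\<^sub>0 \<longleftrightarrow> (\<exists>\<eta> U \<psi>. KL_with \<phi> x\<^sub>0 \<eta> U \<psi>)"

definition KL_exponent_at :: "real \<Rightarrow> ('a::euclidean_space \<Rightarrow> real) \<Rightarrow> 'a \<Rightarrow> bool" where
  "KL_exponent_at \<theta> \<phi> x\<^sub>0 \<longleftrightarrow>
     0 \<le> \<theta> \<and> \<theta> < 1 \<and>
     (\<exists>\<eta> U C. C > 0 \<and> KL_with \<phi> x\<^sub>0 \<eta> U (\<lambda>s. C * s powr (1 - \<theta>)))"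

definition KL_function :: "('a::euclidean_space \<Rightarrow> real) \<Rightarrow> bool" where
  "KL_function \<phi> \<longleftrightarrow> (\<forall>x. KL_at \<phi> x)"

definition KL_function_exponent :: "real \<Rightarrow> ('a::euclidean_space \<Rightarrow> real) \<Rightarrow> bool" where
  "KL_function_exponent \<theta> \<phi> \<longleftrightarrow> (\<forall>x. KL_exponent_at \<theta> \<phi> x)"


definition newton_direction ::
  "('a::euclidean_space \<Rightarrow> real) \<Rightarrow> real \<Rightarrow> real \<Rightarrow> 'a \<Rightarrow> real \<Rightarrow> 'a \<Rightarrow> bool" where
  "newton_direction \<phi> m M x \<mu> d \<longleftrightarrow>
     - grad \<phi> x \<in> (\<lambda>z. z + \<mu> *\<^sub>R d) ` gen_hessian \<phi> x d \<and>
     m * (norm d)\<^sup>2 \<le> (- grad \<phi> x) \<bullet> d \<and>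
     norm (grad \<phi> x) \<le> M * norm d"

definition wolfe ::
  "('a::euclidean_space \<Rightarrow> real) \<Rightarrow> real \<Rightarrow> real \<Rightarrow> 'a \<Rightarrow> 'a \<Rightarrow> real \<Rightarrow> bool" where
  "wolfe \<phi> \<sigma>\<^sub>1 \<sigma>\<^sub>2 x d \<tau> \<longleftrightarrow>
     \<phi> (x + \<tau> *\<^sub>R d) \<le> \<phi> x + \<sigma>\<^sub>1 * \<tau> * (grad \<phi> x \<bullet> d) \<and>
     grad \<phi> (x + \<tau> *\<^sub>R d) \<bullet> d \<ge> \<sigma>\<^sub>2 * (grad \<phi> x \<bullet> d)"

text \<open>One pass through the loop. The conjunct \<open>wolfe 1 \<longrightarrow> \<tau> = 1\<close> records that the unit stepsize
  is tried first. After termination the sequence is continued by its last iterate, so that finite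
  and infinite runs are treated alike.\<close>

definition grnm_step ::
  "('a::euclidean_space \<Rightarrow> real) \<Rightarrow> real \<Rightarrow> real \<Rightarrow> real \<Rightarrow> real \<Rightarrow> real \<Rightarrow> 'a \<Rightarrow> 'a \<Rightarrow> bool" where
  "grnm_step \<phi> \<sigma>\<^sub>1 \<sigma>\<^sub>2 m M \<tau>max x y \<longleftrightarrow>
     (if grad \<phi> x = 0 then y = x
      else \<exists>\<mu> d \<tau>. 0 \<le> \<mu> \<and> newton_direction \<phi> m M x \<mu> d \<and>
             0 < \<tau> \<and> \<tau> \<le> \<tau>max \<and> wolfe \<phi> \<sigma>\<^sub>1 \<sigma>\<^sub>2 x d \<tau> \<and>
             (wolfe \<phi> \<sigma>\<^sub>1 \<sigma>\<^sub>2 x d 1 \<longrightarrow> \<tau> = 1) \<and>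
             y = x + \<tau> *\<^sub>R d)"

definition grnm_generated ::
  "('a::euclidean_space \<Rightarrow> real) \<Rightarrow> real \<Rightarrow> real \<Rightarrow> real \<Rightarrow> real \<Rightarrow> real \<Rightarrow> 'a \<Rightarrow> (nat \<Rightarrow> 'a) \<Rightarrow> bool" where
  "grnm_generated \<phi> \<sigma>\<^sub>1 \<sigma>\<^sub>2 m M \<tau>max x\<^sub>0 x \<longleftrightarrow>
     x 0 = x\<^sub>0 \<and> (\<forall>k. grnm_step \<phi> \<sigma>\<^sub>1 \<sigma>\<^sub>2 m M \<tau>max (x k) (x (Suc k)))"

text \<open>Whatever choices produced the iterates \<open>x 0, \<dots>, x k\<close>, a regularization parameter and a
  direction are available at \<open>x k\<close> unless it is stationary.\<close>

definition grnm_well_defined ::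
  "('a::euclidean_space \<Rightarrow> real) \<Rightarrow> real \<Rightarrow> real \<Rightarrow> real \<Rightarrow> real \<Rightarrow> real \<Rightarrow> 'a \<Rightarrow> bool" where
  "grnm_well_defined \<phi> \<sigma>\<^sub>1 \<sigma>\<^sub>2 m M \<tau>max x\<^sub>0 \<longleftrightarrow>
     (\<forall>x (k::nat).
        x 0 = x\<^sub>0 \<and> (\<forall>i<k. grnm_step \<phi> \<sigma>\<^sub>1 \<sigma>\<^sub>2 m M \<tau>max (x i) (x (Suc i))) \<and> grad \<phi> (x k) \<noteq> 0 \<longrightarrow>
        (\<exists>\<mu>\<ge>0. \<exists>d. newton_direction \<phi> m M (x k) \<mu> d))"

end

theory Submission
  imports Defs
begin

text \<open>Solvability in step (2): for a strongly monotone shift \<open>G = \<nabla>\<phi> + \<mu> I\<close>, maximizing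
  \<open>w \<bullet> y - K / 2 * (norm (G y - G x))\<^sup>2\<close> near \<open>x\<close> and letting \<open>K \<rightarrow> \<infinity>\<close> produces proximal normals to the
  graph of \<open>\<nabla>\<phi>\<close> whose limit is the required element of the generalized Hessian; this needs no
  almost-everywhere differentiability.

  Convergence: the Wolfe conditions give both \<open>\<phi>(x\<^sub>k) - \<phi>(x\<^sub>k\<^sub>+\<^sub>1) \<ge> a \<parallel>x\<^sub>k\<^sub>+\<^sub>1 - x\<^sub>k\<parallel>\<^sup>2\<close> and
  \<open>\<parallel>\<nabla>\<phi>(x\<^sub>k)\<parallel> \<le> b \<parallel>x\<^sub>k\<^sub>+\<^sub>1 - x\<^sub>k\<parallel>\<close>. Since the gradient is taken at the current iterate, concavity of
  \<open>\<psi>\<close> and the KL inequality bound \<open>(a / b) \<parallel>x\<^sub>k\<^sub>+\<^sub>1 - x\<^sub>k\<parallel>\<close> directly by a telescoping difference of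
  values of \<open>\<psi>\<close>. For an exponent \<open>\<theta>\<close>, the gap \<open>r\<^sub>k\<close> to the limit value satisfies
  \<open>r\<^sub>k - r\<^sub>k\<^sub>+\<^sub>1 \<ge> c r\<^sub>k\<^sup>2\<^sup>\<theta>\<close>, which yields the rates.

  The case \<open>\<theta> < 1/2\<close> is vacuous: near a minimizer \<open>\<parallel>\<nabla>\<phi>\<parallel>\<^sup>2 \<le> 4 L (\<phi> - min \<phi>)\<close>, so such an exponent
  makes \<open>\<phi>\<close> locally constant there; the set of global minimizers is then open and closed, and \<open>\<phi>\<close>
  is constant, contradicting the bounded level set.\<close>

section \<open>C11 functions near minimizers\<close>

lemma GDERIV_grad:
  assumes "\<phi> differentiable (at x)"
  shows "GDERIV \<phi> x :> grad \<phi> x"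
proof -
  from assms obtain f' where f': "(\<phi> has_derivative f') (at x)"
    by (auto simp: differentiable_def)
  then interpret bounded_linear f' by (rule has_derivative_bounded_linear)
  \<comment> \<open>The Riesz vector of the derivative. Its uniqueness, shown below, gives the
    definite description in \<open>grad\<close> its value.\<close>
  define g where "g = (\<Sum>b\<in>Basis. f' b *\<^sub>R b)"
  have "f' h = h \<bullet> g" for h
  proof -
    have "f' h = f' (\<Sum>b\<in>Basis. (h \<bullet> b) *\<^sub>R b)" by (simp add: euclidean_representation)
    also have "\<dots> = (\<Sum>b\<in>Basis. (h \<bullet> b) * f' b)" by (simp add: sum scaleR)
    also have "\<dots> = h \<bullet> g" by (simp add: g_def inner_sum_right mult.commute)
    finally show ?thesis .
  qed
  then have "f' = (\<lambda>h. h \<bullet> g)" by (rule ext)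
  then have g: "GDERIV \<phi> x :> g" using f' by (simp add: gderiv_def)
  have "g' = g" if "GDERIV \<phi> x :> g'" for g'
  proof -
    have "(\<lambda>h. h \<bullet> g') = (\<lambda>h. h \<bullet> g)"
      using that g unfolding gderiv_def by (rule has_derivative_unique)
    then have "h \<bullet> g' = h \<bullet> g" for h by (rule fun_cong)
    then show ?thesis by (metis vector_eq_rdot inner_commute)
  qed
  with g show ?thesis unfolding grad_def by (rule theI)
qed

lemma class_C11_GDERIV: "class_C11 \<phi> \<Longrightarrow> GDERIV \<phi> x :> grad \<phi> x"
  by (simp add: class_C11_def GDERIV_grad)

lemma class_C11_continuous_on: "class_C11 \<phi> \<Longrightarrow> continuous_on S \<phi>"
  by (meson class_C11_def continuous_at_imp_continuous_on differentiable_imp_continuous_within)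

text \<open>Local Lipschitz constants become uniform on a compact ball that contains
  \<open>S\<close>. The constant is made positive so that it can serve as a divisor.\<close>

lemma class_C11_lipschitz_on_bounded:
  fixes \<phi> :: "'a::euclidean_space \<Rightarrow> real"
  assumes "class_C11 \<phi>" "bounded S"
  obtains L where "0 < L" "L-lipschitz_on S (grad \<phi>)"
proof -
  obtain e where e: "S \<subseteq> cball 0 e"
    using bounded_subset_ballD[OF assms(2), of 0] ball_subset_cball by blast
  \<comment> \<open>The constant family over the one-point time set \<open>{0}\<close> brings the
    map into the form of a time-dependent locally Lipschitz map, for which compactness yields a
    uniform constant.\<close>
  have "local_lipschitz {0::real} (cball 0 e) (\<lambda>_. grad \<phi>)"
  proof (rule local_lipschitzI)
    fix t :: real and x :: 'a
    obtain r L where r: "r > 0" "L-lipschitz_on (ball x r) (grad \<phi>)"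
      using assms(1) unfolding class_C11_def by blast
    have "L-lipschitz_on (cball x (r/2) \<inter> cball 0 e) (grad \<phi>)"
      by (rule lipschitz_on_subset[OF r(2)]) (use r(1) in auto)
    then show "\<exists>u>0. \<exists>L. \<forall>t\<in>cball t u \<inter> {0}. L-lipschitz_on (cball x u \<inter> cball 0 e) (grad \<phi>)"
      using r(1) by (intro exI[of _ "r/2"]) auto
  qed
  from local_lipschitz_compact_implies_lipschitz[OF this]
  obtain L where L: "L-lipschitz_on (cball 0 e) (grad \<phi>)"
    by (auto simp: continuous_on_const)
  have "(max L 1)-lipschitz_on S (grad \<phi>)"
    using lipschitz_on_mono[OF lipschitz_on_subset[OF L e]] by simp
  then show thesis by (intro that[of "max L 1"]) auto
qed

text \<open>Mean value theorem on the segment, then the Lipschitz bound at the intermediate point.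
  Bounding the distance of that point from \<open>x\<close> by the whole segment gives
  \<open>L\<close> in place of the sharp \<open>L / 2\<close>.\<close>

lemma descent_inequality:
  assumes "class_C11 \<phi>" "L-lipschitz_on S (grad \<phi>)" "convex S" "x \<in> S" "y \<in> S"
  shows "\<phi> y \<le> \<phi> x + grad \<phi> x \<bullet> (y - x) + L * (norm (y - x))\<^sup>2"
proof -
  define f where "f t = \<phi> (x + t *\<^sub>R (y - x))" for t :: real
  have f: "(f has_real_derivative grad \<phi> (x + t *\<^sub>R (y - x)) \<bullet> (y - x)) (at t)" for t
  proof -
    have "((\<lambda>t. x + t *\<^sub>R (y - x)) has_derivative (\<lambda>h. h *\<^sub>R (y - x))) (at t)"
      by (auto intro!: derivative_eq_intros)
    moreover have "(\<phi> has_derivative (\<lambda>h. h \<bullet> grad \<phi> (x + t *\<^sub>R (y - x)))) (at (x + t *\<^sub>R (y - x)))"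
      using class_C11_GDERIV[OF assms(1)] by (simp add: gderiv_def)
    ultimately have "(f has_derivative (\<lambda>h. (h *\<^sub>R (y - x)) \<bullet> grad \<phi> (x + t *\<^sub>R (y - x)))) (at t)"
      unfolding f_def by (rule has_derivative_compose)
    then show ?thesis
      by (simp add: has_field_derivative_def mult_commute_abs inner_commute)
  qed
  obtain t where t: "0 < t" "t < 1" "f 1 - f 0 = (1 - 0) * (grad \<phi> (x + t *\<^sub>R (y - x)) \<bullet> (y - x))"
    using MVT2[of 0 1 f "\<lambda>t. grad \<phi> (x + t *\<^sub>R (y - x)) \<bullet> (y - x)"] f by auto
  define z where "z = x + t *\<^sub>R (y - x)"
  have "z = (1 - t) *\<^sub>R x + t *\<^sub>R y" by (simp add: z_def algebra_simps)
  then have "z \<in> S" using assms(3-5) t by (simp add: convexD_alt)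
  then have "norm (grad \<phi> z - grad \<phi> x) \<le> L * norm (z - x)"
    using lipschitz_onD[OF assms(2)] assms(4) by (simp add: dist_norm)
  also have "\<dots> \<le> L * norm (y - x)"
    using t lipschitz_on_nonneg[OF assms(2)]
    by (intro mult_left_mono) (auto simp: z_def mult_le_cancel_right1 mult_left_le_one_le)
  finally have "norm (grad \<phi> z - grad \<phi> x) * norm (y - x) \<le> L * norm (y - x) * norm (y - x)"
    by (rule mult_right_mono) simp
  moreover have "(grad \<phi> z - grad \<phi> x) \<bullet> (y - x) \<le> norm (grad \<phi> z - grad \<phi> x) * norm (y - x)"
    by (rule norm_cauchy_schwarz)
  ultimately have "(grad \<phi> z - grad \<phi> x) \<bullet> (y - x) \<le> L * (norm (y - x))\<^sup>2"
    by (simp add: power2_eq_square)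
  moreover have "\<phi> y - \<phi> x = grad \<phi> z \<bullet> (y - x)"
    using t by (simp add: f_def z_def)
  ultimately show ?thesis by (simp add: inner_diff_left)
qed

section \<open>Local minimizers and KL exponents below one half\<close>

lemma local_minimizer_grad_eq_0:
  assumes "class_C11 \<phi>" "local_minimizer \<phi> x"
  shows "grad \<phi> x = 0"
proof -
  obtain e where e: "e > 0" "\<And>y. y \<in> ball x e \<Longrightarrow> \<phi> x \<le> \<phi> y"
    using assms(2) unfolding local_minimizer_def eventually_nhds_metric
    by (auto simp: dist_commute)
  have "(\<phi> has_derivative (\<lambda>h. h \<bullet> grad \<phi> x)) (at x)"
    using class_C11_GDERIV[OF assms(1)] by (simp add: gderiv_def)
  then have "(\<lambda>h. h \<bullet> grad \<phi> x) = (\<lambda>h. 0)"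
    using differential_zero_maxmin[of x "ball x e" \<phi>] e by auto
  then have "grad \<phi> x \<bullet> grad \<phi> x = 0" by (rule fun_cong)
  then show ?thesis by simp
qed

text \<open>One gradient step of length \<open>1 / (2 L)\<close> cannot decrease \<open>\<phi>\<close> below its local minimum.\<close>

lemma norm_grad_le_near_local_minimizer:
  assumes "class_C11 \<phi>" "local_minimizer \<phi> x"
  obtains L where "0 < L" "\<forall>\<^sub>F y in nhds x. (norm (grad \<phi> y))\<^sup>2 \<le> 4 * L * (\<phi> y - \<phi> x)"
proof -
  obtain e where e: "e > 0" "\<And>y. y \<in> ball x e \<Longrightarrow> \<phi> x \<le> \<phi> y"
    using assms(2) unfolding local_minimizer_def eventually_nhds_metric
    by (auto simp: dist_commute)
  obtain L where L: "0 < L" "L-lipschitz_on (ball x e) (grad \<phi>)"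
    using class_C11_lipschitz_on_bounded[OF assms(1), of "ball x e"] by auto
  have "(norm (grad \<phi> y))\<^sup>2 \<le> 4 * L * (\<phi> y - \<phi> x)" if y: "dist y x < e / 2" for y
  proof -
    define z where "z = y - (1 / (2 * L)) *\<^sub>R grad \<phi> y"
    have yb: "y \<in> ball x e" using y e(1) by (simp add: dist_commute)
    \<comment> \<open>Comparison with the stationary point \<open>x\<close> shows that the gradient
      step is no longer than \<open>dist y x < e / 2\<close>, so \<open>z\<close> stays in the ball
      where \<open>x\<close> is minimal.\<close>
    have "norm (grad \<phi> y) \<le> L * dist y x"
      using lipschitz_onD[OF L(2) yb, of x] e(1) local_minimizer_grad_eq_0[OF assms]
      by (simp add: dist_norm)
    also have "\<dots> \<le> L * (2 * dist y x)" using L(1) by (intro mult_left_mono) auto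
    finally have "norm (z - y) \<le> dist y x"
      using L(1) by (simp add: z_def field_simps)
    then have "dist z x < e" using dist_triangle[of z x y] y by (simp add: dist_norm)
    then have zb: "z \<in> ball x e" by (simp add: dist_commute)
    have "\<phi> x \<le> \<phi> z" using e(2) zb by blast
    also have "\<dots> \<le> \<phi> y + grad \<phi> y \<bullet> (z - y) + L * (norm (z - y))\<^sup>2"
      by (rule descent_inequality[OF assms(1) L(2) _ yb zb]) simp
    also have "\<dots> = \<phi> y - (norm (grad \<phi> y))\<^sup>2 / (4 * L)"
      using L(1) by (simp add: z_def dot_square_norm field_simps power2_eq_square)
    finally have "(norm (grad \<phi> y))\<^sup>2 / (4 * L) \<le> \<phi> y - \<phi> x" by simp
    then show ?thesis using L(1) by (simp add: pos_divide_le_eq mult.commute)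
  qed
  then have "\<forall>\<^sub>F y in nhds x. (norm (grad \<phi> y))\<^sup>2 \<le> 4 * L * (\<phi> y - \<phi> x)"
    unfolding eventually_nhds_metric using e(1) by (intro exI[of _ "e / 2"]) auto
  with L(1) show thesis by (rule that)
qed

text \<open>Differentiating the power and absorbing the factor \<open>1 - \<theta>\<close> into the
  constant gives the KL inequality in the form used for all estimates with an exponent.\<close>

lemma KL_exponent_atE:
  assumes "KL_exponent_at \<theta> \<phi> x"
  obtains C \<eta> where "0 < C" "0 < \<eta>"
    "\<forall>\<^sub>F y in nhds x. \<phi> x < \<phi> y \<and> \<phi> y < \<phi> x + \<eta> \<longrightarrow> (\<phi> y - \<phi> x) powr \<theta> \<le> C * norm (grad \<phi> y)"
proof -
  from assms obtain \<eta> U C where \<theta>: "0 \<le> \<theta>" "\<theta> < 1" and C: "C > 0"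
    and KL: "KL_with \<phi> x \<eta> U (\<lambda>s. C * s powr (1 - \<theta>))"
    by (auto simp: KL_exponent_at_def)
  then have \<eta>: "0 < \<eta>" and U: "open U" "x \<in> U" by (auto simp: KL_with_def)
  \<comment> \<open>\<open>\<eta>\<close> may be infinite; a finite positive height below it
    replaces it.\<close>
  obtain h where h: "0 < h" "ereal h < \<eta>" using ereal_dense2[OF \<eta>] by (auto simp: zero_ereal_def)
  have "(\<phi> y - \<phi> x) powr \<theta> \<le> C * (1 - \<theta>) * norm (grad \<phi> y)"
    if y: "y \<in> U" "\<phi> x < \<phi> y" "\<phi> y < \<phi> x + h" for y
  proof -
    define s where "s = \<phi> y - \<phi> x"
    have s: "s > 0" using y by (simp add: s_def)
    have "((\<lambda>s. C * s powr (1 - \<theta>)) has_real_derivative C * ((1 - \<theta>) * s powr (- \<theta>))) (at s)"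
      using s by (auto intro!: derivative_eq_intros)
    then have d: "deriv (\<lambda>s. C * s powr (1 - \<theta>)) s = C * ((1 - \<theta>) * s powr (- \<theta>))"
      by (rule DERIV_imp_deriv)
    have "ereal (\<phi> y) < ereal (\<phi> x + h)" using y by simp
    also have "\<dots> \<le> ereal (\<phi> x) + \<eta>"
      using h(2) by (metis add_left_mono less_imp_le plus_ereal.simps(1))
    finally have "1 \<le> C * ((1 - \<theta>) * s powr (- \<theta>)) * norm (grad \<phi> y)"
      using KL y d by (auto simp: KL_with_def s_def)
    then have "1 * s powr \<theta> \<le> C * ((1 - \<theta>) * s powr (- \<theta>)) * norm (grad \<phi> y) * s powr \<theta>"
      by (rule mult_right_mono) simp
    also have "\<dots> = C * (1 - \<theta>) * norm (grad \<phi> y) * (s powr (- \<theta>) * s powr \<theta>)" by simp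
    also have "s powr (- \<theta>) * s powr \<theta> = 1" using s by (simp flip: powr_add)
    finally show ?thesis by (simp add: s_def)
  qed
  then have "\<forall>\<^sub>F y in nhds x. \<phi> x < \<phi> y \<and> \<phi> y < \<phi> x + h
      \<longrightarrow> (\<phi> y - \<phi> x) powr \<theta> \<le> C * (1 - \<theta>) * norm (grad \<phi> y)"
    unfolding eventually_nhds using U by blast
  then show thesis using C \<theta> h by (intro that[of "C * (1 - \<theta>)" h]) auto
qed

text \<open>For a positive gap \<open>s\<close> the upper and lower gradient bounds combine to
  \<open>s powr (2 * \<theta>) \<le> 4 * L * C\<^sup>2 * s\<close>. This keeps
  \<open>s powr (1 - 2 * \<theta>)\<close> away from 0, which fails for small \<open>s\<close> since
  the exponent is positive.\<close>

lemma eventually_const_if_KL_exponent_lt_half: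
  assumes "class_C11 \<phi>" "local_minimizer \<phi> x" "KL_exponent_at \<theta> \<phi> x" "\<theta> < 1/2"
  shows "\<forall>\<^sub>F y in nhds x. \<phi> y = \<phi> x"
proof -
  obtain C \<eta> where C: "0 < C" "0 < \<eta>"
    "\<forall>\<^sub>F y in nhds x. \<phi> x < \<phi> y \<and> \<phi> y < \<phi> x + \<eta> \<longrightarrow> (\<phi> y - \<phi> x) powr \<theta> \<le> C * norm (grad \<phi> y)"
    using assms(3) by (rule KL_exponent_atE)
  obtain L where L: "0 < L" "\<forall>\<^sub>F y in nhds x. (norm (grad \<phi> y))\<^sup>2 \<le> 4 * L * (\<phi> y - \<phi> x)"
    using assms(1,2) by (rule norm_grad_le_near_local_minimizer)
  \<comment> \<open>The second entry is the gap at which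
    \<open>4 * L * C\<^sup>2 * s powr (1 - 2 * \<theta>)\<close> reaches 1.\<close>
  define \<delta> where "\<delta> = min \<eta> ((1 / (4 * L * C\<^sup>2)) powr (1 / (1 - 2 * \<theta>)))"
  have \<delta>: "\<delta> > 0" using C L by (simp add: \<delta>_def)
  have "(\<phi> \<longlongrightarrow> \<phi> x) (nhds x)"
    using class_C11_continuous_on[OF assms(1), of UNIV]
    by (simp add: continuous_on_eq_continuous_at continuous_at tendsto_at_iff_tendsto_nhds)
  then have "\<forall>\<^sub>F y in nhds x. \<phi> y < \<phi> x + \<delta>"
    using \<delta> by (intro order_tendstoD(2)) auto
  with C(3) L(2) assms(2)[unfolded local_minimizer_def] show ?thesis
  proof eventually_elim
    case (elim y)
    show ?case
    proof (rule ccontr)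
      assume "\<phi> y \<noteq> \<phi> x"
      define s where "s = \<phi> y - \<phi> x"
      have s: "s > 0" "s < \<delta>" using elim \<open>\<phi> y \<noteq> \<phi> x\<close> by (auto simp: s_def)
      have "s powr \<theta> \<le> C * norm (grad \<phi> y)" using elim s by (auto simp: s_def \<delta>_def)
      then have "(s powr \<theta>)\<^sup>2 \<le> (C * norm (grad \<phi> y))\<^sup>2" by (rule power_mono) simp
      also have "\<dots> = C\<^sup>2 * (norm (grad \<phi> y))\<^sup>2" by (simp add: power_mult_distrib)
      also have "\<dots> \<le> C\<^sup>2 * (4 * L * s)" using elim by (intro mult_left_mono) (auto simp: s_def)
      finally have "s powr (2 * \<theta>) \<le> 4 * L * C\<^sup>2 * s"
        by (simp add: powr_powr power2_eq_square flip: powr_add) (simp add: algebra_simps)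
      moreover have "s powr (1 - 2 * \<theta>) * s powr (2 * \<theta>) = s" using s by (simp flip: powr_add)
      ultimately have "s powr (2 * \<theta>) * 1 \<le> s powr (2 * \<theta>) * (4 * L * C\<^sup>2 * s powr (1 - 2 * \<theta>))"
        by (simp add: mult_ac)
      then have "1 \<le> 4 * L * C\<^sup>2 * s powr (1 - 2 * \<theta>)"
        using s by (subst (asm) mult_le_cancel_left_pos) auto
      then have "1 / (4 * L * C\<^sup>2) \<le> s powr (1 - 2 * \<theta>)"
        using C L by (simp add: field_simps)
      then have "(1 / (4 * L * C\<^sup>2)) powr (1 / (1 - 2 * \<theta>)) \<le> (s powr (1 - 2 * \<theta>)) powr (1 / (1 - 2 * \<theta>))"
        using C L assms(4) by (intro powr_mono2) auto
      also have "\<dots> = s" using s assms(4) by (simp add: powr_powr)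
      finally show False using s(2) by (simp add: \<delta>_def)
    qed
  qed
qed

text \<open>Compactness of the level set provides one global minimizer; the KL hypothesis at every
  global minimizer and connectedness of the space then spread its value everywhere.\<close>

lemma not_KL_function_exponent_lt_half:
  fixes \<phi> :: "'a::euclidean_space \<Rightarrow> real"
  assumes "class_C11 \<phi>" "bounded {x. \<phi> x \<le> \<phi> x\<^sub>0}" "\<theta> < 1/2"
  shows "\<not> KL_function_exponent \<theta> \<phi>"
proof
  assume KL: "KL_function_exponent \<theta> \<phi>"
  have cont: "continuous_on S \<phi>" for S using assms(1) by (rule class_C11_continuous_on)
  have "closed {x. \<phi> x \<le> \<phi> x\<^sub>0}" by (intro closed_Collect_le cont continuous_on_const)
  then have "compact {x. \<phi> x \<le> \<phi> x\<^sub>0}" using assms(2) by (simp add: compact_eq_bounded_closed)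
  then obtain z where z: "\<phi> z \<le> \<phi> x\<^sub>0" "\<And>y. \<phi> y \<le> \<phi> x\<^sub>0 \<Longrightarrow> \<phi> z \<le> \<phi> y"
    using continuous_attains_inf[OF _ _ cont, of "{x. \<phi> x \<le> \<phi> x\<^sub>0}"] by auto
  then have min: "\<phi> z \<le> \<phi> y" for y by (meson le_cases order_trans)
  let ?A = "{y. \<phi> y = \<phi> z}"
  have "open ?A"
  proof (subst open_subopen, intro ballI)
    fix y assume y: "y \<in> ?A"
    then have "local_minimizer \<phi> y" by (simp add: local_minimizer_def min)
    then have "\<forall>\<^sub>F u in nhds y. \<phi> u = \<phi> y"
      using assms(1,3) KL by (intro eventually_const_if_KL_exponent_lt_half) (auto simp: KL_function_exponent_def)
    then show "\<exists>T. open T \<and> y \<in> T \<and> T \<subseteq> ?A"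
      using y by (auto simp: eventually_nhds)
  qed
  moreover have "closed ?A" by (intro closed_Collect_eq cont continuous_on_const)
  ultimately have A: "?A = UNIV" using clopen[of ?A] by auto
  have "\<phi> y \<le> \<phi> x\<^sub>0" for y
  proof -
    have "y \<in> ?A" by (simp only: A UNIV_I)
    then show ?thesis using z(1) by simp
  qed
  then have "{x. \<phi> x \<le> \<phi> x\<^sub>0} = UNIV" by auto
  with assms(2) show False using not_bounded_UNIV by metis
qed

section \<open>Solvability of the Newton inclusion\<close>

text \<open>Proximal normals are regular normals: after division by \<open>norm (y - z)\<close> the
  quadratic bound tends to 0.\<close>

lemma regular_normal_coneI:
  assumes "0 < r"
    and "\<And>y. y \<in> \<Omega> \<Longrightarrow> dist y z < r \<Longrightarrow> v \<bullet> (y - z) \<le> Q * (norm (y - z))\<^sup>2"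
  shows "v \<in> regular_normal_cone \<Omega> z"
proof -
  have "Limsup (at z within \<Omega>) (\<lambda>y. ereal (v \<bullet> (y - z) / norm (y - z))) \<le> 0 + ereal e"
    if "0 < e" for e :: real
  proof (rule Limsup_bounded)
    \<comment> \<open>\<open>\<bar>Q\<bar> + 1\<close> is a positive coefficient that dominates
      \<open>Q\<close> whatever its sign.\<close>
    define \<delta> where "\<delta> = min r (e / (\<bar>Q\<bar> + 1))"
    have "\<delta> > 0" using assms(1) that by (simp add: \<delta>_def)
    moreover have "v \<bullet> (y - z) / norm (y - z) \<le> e" if y: "y \<in> \<Omega>" "y \<noteq> z" "dist y z < \<delta>" for y
    proof -
      have n: "norm (y - z) > 0" "norm (y - z) \<le> e / (\<bar>Q\<bar> + 1)"
        using y by (auto simp: \<delta>_def dist_norm)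
      have "v \<bullet> (y - z) \<le> Q * (norm (y - z))\<^sup>2" using assms(2) y by (auto simp: \<delta>_def)
      also have "\<dots> \<le> (\<bar>Q\<bar> + 1) * (norm (y - z))\<^sup>2" by (intro mult_right_mono) auto
      finally have "v \<bullet> (y - z) / norm (y - z) \<le> (\<bar>Q\<bar> + 1) * norm (y - z)"
        using n by (simp add: field_simps power2_eq_square)
      also have "\<dots> \<le> e" using n(2) by (simp add: pos_le_divide_eq mult.commute)
      finally show ?thesis .
    qed
    ultimately show "\<forall>\<^sub>F y in at z within \<Omega>. ereal (v \<bullet> (y - z) / norm (y - z)) \<le> 0 + ereal e"
      unfolding eventually_at by (intro exI[of _ \<delta>]) auto
  qed
  then show ?thesis unfolding regular_normal_cone_def by (auto intro: ereal_le_epsilon2)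
qed

text \<open>Extracts first-order information from a maximum: divide by \<open>t\<close> and let
  \<open>t\<close> tend to 0 from the right.\<close>

lemma le_if_le_add_mult_small:
  fixes A B C :: real
  assumes "0 < t\<^sub>0" "\<And>t. 0 < t \<Longrightarrow> t < t\<^sub>0 \<Longrightarrow> t * A \<le> t * B + t\<^sup>2 * C"
  shows "A \<le> B"
proof (rule tendsto_lowerbound)
  show "((\<lambda>t. B + t * C) \<longlongrightarrow> B) (at_right 0)"
    by (auto intro!: tendsto_eq_intros)
  have "A \<le> B + t * C" if "0 < t" "t < t\<^sub>0" for t
  proof -
    have "t * A \<le> t * (B + t * C)"
      using assms(2)[OF that] by (simp add: algebra_simps power2_eq_square)
    then show ?thesis using that by simp
  qed
  then show "\<forall>\<^sub>F t in at_right 0. A \<le> B + t * C"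
    unfolding eventually_at_right_field using assms(1) by blast
qed simp

text \<open>With \<open>G = F + (L + c) I\<close>, which is strongly monotone near \<open>x\<close>, the point \<open>z\<close> maximizes
  \<open>w \<bullet> y - K / 2 * (norm (G y - G x))\<^sup>2\<close> and \<open>d = K (G z - G x)\<close>. As \<open>K\<close> grows, \<open>z\<close> tends to \<open>x\<close>
  while \<open>d\<close> stays bounded.\<close>

lemma ex_regular_normal_shifted:
  fixes F :: "'a::euclidean_space \<Rightarrow> 'a"
  assumes F: "L-lipschitz_on (ball x r) F" and r: "0 < r" and c: "0 < c"
    and K: "4 * norm w < K * (c\<^sup>2 * r)"
  shows "\<exists>z d. norm (z - x) \<le> 2 * norm w / (K * c\<^sup>2) \<and> norm d \<le> 2 * norm w / c \<and>
    (w - (L + c) *\<^sub>R d, - d) \<in> regular_normal_cone {(y, F y) | y. True} (z, F z) \<and>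
    c * (norm d)\<^sup>2 \<le> w \<bullet> d \<and> norm w \<le> (2 * L + c) * norm d"
proof -
  \<comment> \<open>The shift \<open>\<mu>\<close> exceeds the Lipschitz constant of
    \<open>F\<close> by \<open>c\<close>, so \<open>G\<close> is strongly monotone with modulus
    \<open>c\<close>; \<open>N\<close> is a Lipschitz constant of \<open>G\<close>.\<close>
  define \<mu> where "\<mu> = L + c"
  define N where "N = 2 * L + c"
  define G where "G y = F y + \<mu> *\<^sub>R y" for y
  have L: "L \<ge> 0" using F by (rule lipschitz_on_nonneg)
  then have N: "N > 0" using c by (simp add: N_def)
  have K0: "K > 0"
  proof (rule ccontr)
    assume "\<not> K > 0"
    then have "K * (c\<^sup>2 * r) \<le> 0" using c r by (simp add: mult_nonpos_nonneg)
    then show False using K norm_ge_zero[of w] by linarith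
  qed
  have FL: "norm (F u - F v) \<le> L * norm (u - v)" if "u \<in> ball x r" "v \<in> ball x r" for u v
    using lipschitz_onD[OF F that] by (simp add: dist_norm)
  have mono: "c * (norm (u - v))\<^sup>2 \<le> (G u - G v) \<bullet> (u - v)" if "u \<in> ball x r" "v \<in> ball x r" for u v
  proof -
    have "\<bar>(F u - F v) \<bullet> (u - v)\<bar> \<le> norm (F u - F v) * norm (u - v)" by (rule Cauchy_Schwarz_ineq2)
    also have "\<dots> \<le> L * norm (u - v) * norm (u - v)" by (intro mult_right_mono FL that) simp
    finally have "- (L * (norm (u - v))\<^sup>2) \<le> (F u - F v) \<bullet> (u - v)"
      by (simp add: power2_eq_square)
    moreover have "(G u - G v) \<bullet> (u - v) = (F u - F v) \<bullet> (u - v) + \<mu> * (norm (u - v))\<^sup>2"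
      by (simp add: G_def inner_diff_left inner_diff_right inner_add_left algebra_simps power2_norm_eq_inner)
    ultimately show ?thesis by (simp add: \<mu>_def algebra_simps)
  qed
  have expand: "c * norm (u - v) \<le> norm (G u - G v)" if "u \<in> ball x r" "v \<in> ball x r" for u v
  proof (cases "u = v")
    case False
    have "c * norm (u - v) * norm (u - v) \<le> norm (G u - G v) * norm (u - v)"
      using mono[OF that] norm_cauchy_schwarz[of "G u - G v" "u - v"] by (simp add: power2_eq_square)
    then show ?thesis using False by simp
  qed simp
  have lip: "norm (G u - G v) \<le> N * norm (u - v)" if "u \<in> ball x r" "v \<in> ball x r" for u v
  proof -
    have "G u - G v = (F u - F v) + \<mu> *\<^sub>R (u - v)" by (simp add: G_def algebra_simps)
    then have "norm (G u - G v) \<le> norm (F u - F v) + norm (\<mu> *\<^sub>R (u - v))"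
      by (metis norm_triangle_ineq)
    also have "\<dots> \<le> L * norm (u - v) + \<mu> * norm (u - v)"
      using FL[OF that] L c by (simp add: \<mu>_def)
    finally show ?thesis by (simp add: N_def \<mu>_def algebra_simps)
  qed
  have sub: "cball x (r/2) \<subseteq> ball x r" using r by auto
  have "continuous_on (cball x (r/2)) F"
    using lipschitz_on_continuous_on[OF F] sub continuous_on_subset by blast
  then have "continuous_on (cball x (r/2)) (\<lambda>y. w \<bullet> y - K / 2 * (norm (G y - G x))\<^sup>2)"
    unfolding G_def by (intro continuous_intros)
  then obtain z where z: "z \<in> cball x (r/2)" and zmax: "\<And>y. y \<in> cball x (r/2) \<Longrightarrow>
      w \<bullet> y - K / 2 * (norm (G y - G x))\<^sup>2 \<le> w \<bullet> z - K / 2 * (norm (G z - G x))\<^sup>2"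
    using continuous_attains_sup[of "cball x (r/2)"] r by fastforce
  have zb: "z \<in> ball x r" and xb: "x \<in> ball x r" using z sub r by auto
  define d where "d = K *\<^sub>R (G z - G x)"
  have nd: "norm d = K * norm (G z - G x)" using K0 by (simp add: d_def)
  \<comment> \<open>The maximal value is compared with the value at \<open>x\<close>, where the
    penalty vanishes.\<close>
  have zx: "K / 2 * (norm (G z - G x))\<^sup>2 \<le> norm w * norm (z - x)"
  proof -
    have "K / 2 * (norm (G z - G x))\<^sup>2 \<le> w \<bullet> (z - x)"
      using zmax[of x] r by (simp add: inner_diff_right)
    also have "\<dots> \<le> norm w * norm (z - x)" by (rule norm_cauchy_schwarz)
    finally show ?thesis .
  qed
  have d_le: "norm d \<le> 2 * norm w / c"
  proof (cases "G z = G x")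
    case False
    then have p: "norm (G z - G x) > 0" by simp
    have "c * (K / 2 * (norm (G z - G x))\<^sup>2) \<le> c * (norm w * norm (z - x))"
      using zx c by (intro mult_left_mono) auto
    also have "\<dots> = norm w * (c * norm (z - x))" by simp
    also have "\<dots> \<le> norm w * norm (G z - G x)" by (intro mult_left_mono expand zb xb) simp
    finally have "(c * (K / 2 * norm (G z - G x))) * norm (G z - G x) \<le> norm w * norm (G z - G x)"
      by (simp add: power2_eq_square mult_ac)
    then have "c * (K / 2 * norm (G z - G x)) \<le> norm w" using p by simp
    then show ?thesis using c by (simp add: nd pos_le_divide_eq mult_ac)
  qed (use c in \<open>simp add: nd\<close>)
  have z_le: "norm (z - x) \<le> 2 * norm w / (K * c\<^sup>2)"
  proof -
    have "c * norm (z - x) \<le> norm (G z - G x)" by (rule expand[OF zb xb])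
    also have "\<dots> = norm d / K" using K0 by (simp add: nd)
    also have "\<dots> \<le> (2 * norm w / c) / K" using d_le K0 by (intro divide_right_mono) auto
    finally show ?thesis using c K0 by (simp add: field_simps power2_eq_square)
  qed
  \<comment> \<open>The lower bound on \<open>K\<close> makes the maximizer interior, so that every
    \<open>y\<close> close to \<open>z\<close> is a competitor.\<close>
  also have "\<dots> < r / 2" using K K0 c by (simp add: field_simps)
  finally have z_lt: "norm (z - x) < r / 2" .
  define s where "s = r / 2 - norm (z - x)"
  have s: "s > 0" using z_lt by (simp add: s_def)
  have near: "y \<in> cball x (r/2)" if "norm (y - z) < s" for y
    using that norm_triangle_ineq[of "y - z" "z - x"] by (simp add: s_def dist_norm norm_minus_commute)
  define Q where "Q = K / 2 * N\<^sup>2"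
  \<comment> \<open>First-order optimality of \<open>z\<close> with an explicit quadratic error: the
    squared penalty is expanded around \<open>z\<close>, and the Lipschitz bound for
    \<open>G\<close> controls the second-order term.\<close>
  have key: "w \<bullet> (y - z) \<le> d \<bullet> (G y - G z) + Q * (norm (y - z))\<^sup>2" if y: "norm (y - z) < s" for y
  proof -
    have yb: "y \<in> ball x r" using near[OF y] sub by blast
    have "(norm (G y - G x))\<^sup>2 = (norm ((G z - G x) + (G y - G z)))\<^sup>2" by simp
    also have "\<dots> = (norm (G z - G x))\<^sup>2 + 2 * ((G z - G x) \<bullet> (G y - G z)) + (norm (G y - G z))\<^sup>2"
      by (simp only: power2_norm_eq_inner inner_add_left inner_add_right) (simp add: inner_commute)
    finally have "K / 2 * (norm (G y - G x))\<^sup>2 =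
        K / 2 * (norm (G z - G x))\<^sup>2 + d \<bullet> (G y - G z) + K / 2 * (norm (G y - G z))\<^sup>2"
      by (simp add: d_def distrib_left)
    moreover have "K / 2 * (norm (G y - G z))\<^sup>2 \<le> K / 2 * (N * norm (y - z))\<^sup>2"
      using K0 lip[OF yb zb] by (intro mult_left_mono power_mono) auto
    ultimately show ?thesis using zmax[OF near[OF y]]
      by (simp add: Q_def power_mult_distrib inner_diff_right algebra_simps)
  qed
  have "(w - \<mu> *\<^sub>R d, - d) \<in> regular_normal_cone {(y, F y) | y. True} (z, F z)"
  proof (rule regular_normal_coneI[OF s])
    fix p assume "p \<in> {(y, F y) | y. True}" and p: "dist p (z, F z) < s"
    then obtain y where y: "p = (y, F y)" by auto
    have n: "norm (y - z) \<le> norm (p - (z, F z))"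
      unfolding y by (simp add: norm_Pair real_le_rsqrt)
    then have ys: "norm (y - z) < s" using p by (simp add: dist_norm)
    \<comment> \<open>The shift in the first component turns differences of \<open>F\<close> into
      differences of \<open>G\<close>, to which \<open>key\<close> applies.\<close>
    have "(w - \<mu> *\<^sub>R d, - d) \<bullet> (p - (z, F z)) = w \<bullet> (y - z) - d \<bullet> (G y - G z)"
      unfolding y by (simp add: G_def algebra_simps)
    also have "\<dots> \<le> Q * (norm (y - z))\<^sup>2" using key[OF ys] by simp
    also have "\<dots> \<le> Q * (norm (p - (z, F z)))\<^sup>2"
      using n K0 by (intro mult_left_mono power_mono) (auto simp: Q_def)
    finally show "(w - \<mu> *\<^sub>R d, - d) \<bullet> (p - (z, F z)) \<le> Q * (norm (p - (z, F z)))\<^sup>2" .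
  qed
  moreover have "c * (norm d)\<^sup>2 \<le> w \<bullet> d"
  proof (rule le_if_le_add_mult_small[where C = "Q * (norm d)\<^sup>2" and t\<^sub>0 = "s / (norm d + 1)"])
    show "0 < s / (norm d + 1)" using s by (simp add: add_nonneg_pos)
    fix t assume t: "0 < t" "t < s / (norm d + 1)"
    \<comment> \<open>Testing optimality against \<open>d\<close> lets strong monotonicity of
      \<open>G\<close> bound \<open>w \<bullet> d\<close> from below. The summand 1 in the range of
      \<open>t\<close> covers \<open>d = 0\<close>.\<close>
    define y where "y = z - t *\<^sub>R d"
    have "t * norm d \<le> t * (norm d + 1)" using t(1) by simp
    also have "\<dots> < s" using t(2) by (simp add: pos_less_divide_eq add_nonneg_pos)
    finally have ys: "norm (y - z) < s" using t(1) by (simp add: y_def)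
    have yb: "y \<in> ball x r" using near[OF ys] sub by blast
    have "c * (t * norm d)\<^sup>2 \<le> - t * (d \<bullet> (G y - G z))"
      using mono[OF yb zb] t(1) by (simp add: y_def inner_commute)
    then have "t * (c * t * (norm d)\<^sup>2) \<le> t * (- (d \<bullet> (G y - G z)))"
      by (simp add: power2_eq_square mult_ac)
    then have "c * t * (norm d)\<^sup>2 \<le> - (d \<bullet> (G y - G z))" using t(1) by (simp only: mult_le_cancel_left_pos)
    then show "t * (c * (norm d)\<^sup>2) \<le> t * (w \<bullet> d) + t\<^sup>2 * (Q * (norm d)\<^sup>2)"
      using key[OF ys] t(1) by (simp add: y_def power_mult_distrib mult_ac)
  qed
  moreover have "norm w \<le> N * norm d"
  proof (cases "w = 0")
    case False
    have "(norm w)\<^sup>2 \<le> N * norm d * norm w"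
    proof (rule le_if_le_add_mult_small[where C = "Q * (norm w)\<^sup>2" and t\<^sub>0 = "s / norm w"])
      show "0 < s / norm w" using s False by simp
      fix t assume t: "0 < t" "t < s / norm w"
      \<comment> \<open>Testing in direction \<open>w\<close> produces
        \<open>(norm w)\<^sup>2\<close> on the left, while the Lipschitz bound for \<open>G\<close>
        limits the right side.\<close>
      define y where "y = z + t *\<^sub>R w"
      have ys: "norm (y - z) < s" using t False by (simp add: y_def pos_less_divide_eq)
      have yb: "y \<in> ball x r" using near[OF ys] sub by blast
      have "d \<bullet> (G y - G z) \<le> norm d * norm (G y - G z)" by (rule norm_cauchy_schwarz)
      also have "\<dots> \<le> norm d * (N * norm (y - z))" by (intro mult_left_mono lip yb zb) simp
      finally have "d \<bullet> (G y - G z) \<le> norm d * (N * (t * norm w))" using t(1) by (simp add: y_def)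
      then show "t * (norm w)\<^sup>2 \<le> t * (N * norm d * norm w) + t\<^sup>2 * (Q * (norm w)\<^sup>2)"
        using key[OF ys] t(1) by (simp add: y_def power_mult_distrib mult_ac power2_norm_eq_inner)
    qed
    then show ?thesis using False by (simp add: power2_eq_square)
  qed (use N in simp)
  ultimately show ?thesis using z_le d_le unfolding \<mu>_def N_def by blast
qed

text \<open>The bound on \<open>d\<close> does not depend on \<open>K\<close>, so a subsequence of
  directions converges while the base points tend to \<open>x\<close>. The limit is a limiting
  normal, and both inequalities survive because they are closed conditions.\<close>

lemma ex_limiting_normal_shifted:
  fixes F :: "'a::euclidean_space \<Rightarrow> 'a"
  assumes F: "L-lipschitz_on (ball x r) F" and r: "0 < r" and c: "0 < c"
  shows "\<exists>d. (w - (L + c) *\<^sub>R d, - d) \<in> limiting_normal_cone {(y, F y) | y. True} (x, F x) \<and>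
    c * (norm d)\<^sup>2 \<le> w \<bullet> d \<and> norm w \<le> (2 * L + c) * norm d"
proof -
  \<comment> \<open>One more than the threshold required of the penalty parameter.\<close>
  define K\<^sub>0 where "K\<^sub>0 = 4 * norm w / (c\<^sup>2 * r) + 1"
  define K where "K k = K\<^sub>0 + real k" for k
  have K: "4 * norm w < K k * (c\<^sup>2 * r)" for k
  proof -
    have "4 * norm w / (c\<^sup>2 * r) < K k" by (simp add: K_def K\<^sub>0_def)
    then show ?thesis using c r by (simp add: pos_divide_less_eq)
  qed
  have "\<forall>k. \<exists>z d. norm (z - x) \<le> 2 * norm w / (K k * c\<^sup>2) \<and> norm d \<le> 2 * norm w / c \<and>
    (w - (L + c) *\<^sub>R d, - d) \<in> regular_normal_cone {(y, F y) | y. True} (z, F z) \<and>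
    c * (norm d)\<^sup>2 \<le> w \<bullet> d \<and> norm w \<le> (2 * L + c) * norm d"
    using ex_regular_normal_shifted[OF F r c K] by blast
  then have "\<exists>z d. \<forall>k. norm (z k - x) \<le> 2 * norm w / (K k * c\<^sup>2) \<and> norm (d k) \<le> 2 * norm w / c \<and>
    (w - (L + c) *\<^sub>R d k, - d k) \<in> regular_normal_cone {(y, F y) | y. True} (z k, F (z k)) \<and>
    c * (norm (d k))\<^sup>2 \<le> w \<bullet> d k \<and> norm w \<le> (2 * L + c) * norm (d k)"
    by (simp only: choice_iff)
  then obtain z d where z: "\<And>k. norm (z k - x) \<le> 2 * norm w / (K k * c\<^sup>2)"
    and d: "\<And>k. norm (d k) \<le> 2 * norm w / c"
      "\<And>k. (w - (L + c) *\<^sub>R d k, - d k) \<in> regular_normal_cone {(y, F y) | y. True} (z k, F (z k))"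
      "\<And>k. c * (norm (d k))\<^sup>2 \<le> w \<bullet> d k" "\<And>k. norm w \<le> (2 * L + c) * norm (d k)"
    by blast
  have "bounded (range d)" using d(1) by (auto simp: bounded_iff)
  then obtain d' \<rho> where \<rho>: "strict_mono \<rho>" "(d \<circ> \<rho>) \<longlonglongrightarrow> d'"
    using bounded_imp_convergent_subsequence by blast
  have d': "(\<lambda>k. d (\<rho> k)) \<longlonglongrightarrow> d'" using \<rho>(2) by (simp add: comp_def)
  have Klim: "filterlim K at_top sequentially"
    unfolding K_def by (intro filterlim_tendsto_add_at_top[OF tendsto_const] filterlim_real_sequentially)
  have "(\<lambda>k. 2 * norm w / c\<^sup>2 * inverse (K k)) \<longlonglongrightarrow> 2 * norm w / c\<^sup>2 * 0"
    by (intro tendsto_mult tendsto_const tendsto_inverse_0_at_top Klim)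
  then have "(\<lambda>k. 2 * norm w / (K k * c\<^sup>2)) \<longlonglongrightarrow> 0" by (simp add: divide_simps mult.commute)
  then have "(\<lambda>k. z k - x) \<longlonglongrightarrow> 0"
    by (rule Lim_null_comparison[rotated]) (simp add: z)
  then have "z \<longlonglongrightarrow> x" by (simp add: LIM_zero_iff)
  then have zr: "(\<lambda>k. z (\<rho> k)) \<longlonglongrightarrow> x" using LIMSEQ_subseq_LIMSEQ[OF _ \<rho>(1)] by (auto simp: comp_def)
  have "continuous_on (ball x r) F" using F by (rule lipschitz_on_continuous_on)
  then have "isCont F x" using r by (simp add: continuous_on_eq_continuous_at)
  then have "(\<lambda>k. F (z (\<rho> k))) \<longlonglongrightarrow> F x" using zr by (rule isCont_tendsto_compose)
  then have zF: "(\<lambda>k. (z (\<rho> k), F (z (\<rho> k)))) \<longlonglongrightarrow> (x, F x)" by (intro tendsto_Pair zr)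
  have "(w - (L + c) *\<^sub>R d', - d') \<in> limiting_normal_cone {(y, F y) | y. True} (x, F x)"
    unfolding limiting_normal_cone_def
  proof (intro CollectI exI conjI allI)
    show "(\<lambda>k. (w - (L + c) *\<^sub>R d (\<rho> k), - d (\<rho> k))) \<longlonglongrightarrow> (w - (L + c) *\<^sub>R d', - d')"
      by (intro tendsto_intros d')
  qed (use d(2) zF in auto)
  moreover have "c * (norm d')\<^sup>2 \<le> w \<bullet> d'"
    by (rule LIMSEQ_le[of "\<lambda>k. c * (norm (d (\<rho> k)))\<^sup>2" _ "\<lambda>k. w \<bullet> d (\<rho> k)"])
      (use d(3) in \<open>auto intro!: tendsto_intros d'\<close>)
  moreover have "norm w \<le> (2 * L + c) * norm d'"
    by (rule LIMSEQ_le_const[of "\<lambda>k. (2 * L + c) * norm (d (\<rho> k))"])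
      (use d(4) in \<open>auto intro!: tendsto_intros d'\<close>)
  ultimately show ?thesis by blast
qed

text \<open>Here \<open>w = - grad \<phi> x\<close>, \<open>c = m\<close>, and the regularization
  parameter is \<open>L + m\<close>. The bound required of \<open>M\<close> is the Lipschitz
  constant of the shifted gradient.\<close>

lemma ex_newton_direction:
  assumes "L-lipschitz_on (ball x r) (grad \<phi>)" "0 < r" "0 < m" "2 * L + m \<le> M"
  shows "\<exists>\<mu>\<ge>0. \<exists>d. newton_direction \<phi> m M x \<mu> d"
proof -
  obtain d where d: "(- grad \<phi> x - (L + m) *\<^sub>R d, - d) \<in>
      limiting_normal_cone {(y, grad \<phi> y) | y. True} (x, grad \<phi> x)"
    "m * (norm d)\<^sup>2 \<le> (- grad \<phi> x) \<bullet> d" "norm (- grad \<phi> x) \<le> (2 * L + m) * norm d"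
    using ex_limiting_normal_shifted[OF assms(1-3)] by blast
  have "- grad \<phi> x \<in> (\<lambda>z. z + (L + m) *\<^sub>R d) ` gen_hessian \<phi> x d"
    by (rule image_eqI[of _ _ "- grad \<phi> x - (L + m) *\<^sub>R d"]) (use d(1) in \<open>auto simp: gen_hessian_def\<close>)
  moreover have "norm (grad \<phi> x) \<le> M * norm d"
    using d(3) mult_right_mono[OF assms(4), of "norm d"] by simp
  moreover have "L + m \<ge> 0" using lipschitz_on_nonneg[OF assms(1)] assms(3) by simp
  ultimately show ?thesis using d(2) unfolding newton_direction_def by blast
qed

section \<open>Well-definedness of the algorithm\<close>

lemma grnm_step_decrease:
  assumes "grnm_step \<phi> \<sigma>\<^sub>1 \<sigma>\<^sub>2 m M \<tau>max x y" "0 < m" "0 < \<sigma>\<^sub>1"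
  shows "\<phi> y \<le> \<phi> x"
proof (cases "grad \<phi> x = 0")
  case False
  with assms(1) obtain d \<tau> where d: "m * (norm d)\<^sup>2 \<le> (- grad \<phi> x) \<bullet> d" "0 < \<tau>"
    "wolfe \<phi> \<sigma>\<^sub>1 \<sigma>\<^sub>2 x d \<tau>" "y = x + \<tau> *\<^sub>R d"
    by (auto simp: grnm_step_def newton_direction_def)
  have "0 \<le> m * (norm d)\<^sup>2" using assms(2) by simp
  then have "grad \<phi> x \<bullet> d \<le> 0" using d(1) by simp
  then have "\<sigma>\<^sub>1 * \<tau> * (grad \<phi> x \<bullet> d) \<le> 0"
    using assms(3) d(2) by (simp add: mult_nonneg_nonpos)
  then show ?thesis using d(3,4) by (simp add: wolfe_def)
qed (use assms(1) in \<open>simp add: grnm_step_def\<close>)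

text \<open>A threshold for \<open>M\<close> is unavoidable: for a one-dimensional quadratic with
  second derivative larger than \<open>M\<close> no \<open>\<mu> \<ge> 0\<close> is admissible away
  from the minimizer. Monotone values keep all iterates in the level set, so one Lipschitz constant
  serves every step.\<close>

lemma ex_grnm_well_defined:
  fixes \<phi> :: "'a::euclidean_space \<Rightarrow> real"
  assumes "class_C11 \<phi>" "0 < \<sigma>\<^sub>1" "bounded {x. \<phi> x \<le> \<phi> x\<^sub>0}" "0 < m"
  shows "\<exists>M\<^sub>0. \<forall>M. m < M \<and> M\<^sub>0 \<le> M \<longrightarrow> grnm_well_defined \<phi> \<sigma>\<^sub>1 \<sigma>\<^sub>2 m M \<tau>max x\<^sub>0"
proof -
  obtain e where e: "{x. \<phi> x \<le> \<phi> x\<^sub>0} \<subseteq> ball 0 e"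
    using bounded_subset_ballD[OF assms(3), of 0] by blast
  \<comment> \<open>The radius is enlarged by 1 to contain the unit ball around each
    iterate.\<close>
  obtain L where L: "L-lipschitz_on (ball 0 (e + 1)) (grad \<phi>)"
    using class_C11_lipschitz_on_bounded[OF assms(1) bounded_ball] by blast
  have "grnm_well_defined \<phi> \<sigma>\<^sub>1 \<sigma>\<^sub>2 m M \<tau>max x\<^sub>0" if M: "2 * L + m \<le> M" for M
    unfolding grnm_well_defined_def
  proof (intro allI impI, elim conjE)
    fix x :: "nat \<Rightarrow> 'a" and k
    assume x: "x 0 = x\<^sub>0" "\<forall>i<k. grnm_step \<phi> \<sigma>\<^sub>1 \<sigma>\<^sub>2 m M \<tau>max (x i) (x (Suc i))"
    have "i \<le> k \<Longrightarrow> \<phi> (x i) \<le> \<phi> x\<^sub>0" for i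
    proof (induction i)
      case (Suc i)
      then have "\<phi> (x (Suc i)) \<le> \<phi> (x i)"
        using x(2) grnm_step_decrease[OF _ assms(4,2)] Suc_le_lessD by blast
      with Suc show ?case by simp
    qed (simp add: x)
    then have "x k \<in> ball 0 e" using e by blast
    then have "norm (x k) < e" by simp
    then have "ball (x k) 1 \<subseteq> ball 0 (e + 1)" by (simp add: ball_subset_ball_iff)
    then have "L-lipschitz_on (ball (x k) 1) (grad \<phi>)" by (rule lipschitz_on_subset[OF L])
    then show "\<exists>\<mu>\<ge>0. \<exists>d. newton_direction \<phi> m M (x k) \<mu> d"
      by (rule ex_newton_direction) (use assms(4) M in auto)
  qed
  then show ?thesis by blast
qed

section \<open>Descent sequences and the KL property\<close>

text \<open>The first Wolfe condition gives the decrease. The second one and the Lipschitz bound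
  keep the stepsize away from 0, so \<open>norm d\<close> is controlled by the length of the
  step.\<close>

lemma grnm_steps_decrease_and_error_bound:
  fixes \<phi> :: "'a::euclidean_space \<Rightarrow> real"
  assumes "class_C11 \<phi>" "0 < \<sigma>\<^sub>1" "\<sigma>\<^sub>2 < 1" "bounded {x. \<phi> x \<le> \<phi> x\<^sub>0}" "0 < m" "m < M"
    and gen: "grnm_generated \<phi> \<sigma>\<^sub>1 \<sigma>\<^sub>2 m M \<tau>max x\<^sub>0 x"
  obtains a b where "0 < a" "0 < b"
    "\<And>k. a * (norm (x (Suc k) - x k))\<^sup>2 \<le> \<phi> (x k) - \<phi> (x (Suc k))"
    "\<And>k. norm (grad \<phi> (x k)) \<le> b * norm (x (Suc k) - x k)"
proof -
  obtain L where L: "0 < L" "L-lipschitz_on {x. \<phi> x \<le> \<phi> x\<^sub>0} (grad \<phi>)"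
    using class_C11_lipschitz_on_bounded[OF assms(1,4)] .
  have step: "grnm_step \<phi> \<sigma>\<^sub>1 \<sigma>\<^sub>2 m M \<tau>max (x k) (x (Suc k))" for k
    using gen by (simp add: grnm_generated_def)
  have level: "\<phi> (x k) \<le> \<phi> x\<^sub>0" for k
  proof (induction k)
    case (Suc k)
    then show ?case using grnm_step_decrease[OF step assms(5,2)] order_trans by blast
  qed (use gen in \<open>simp add: grnm_generated_def\<close>)
  \<comment> \<open>The lower stepsize bound that results from \<open>(1 - \<sigma>\<^sub>2) * m *
    (norm d)\<^sup>2 \<le> \<tau> * L * (norm d)\<^sup>2\<close>.\<close>
  define \<tau>min where "\<tau>min = (1 - \<sigma>\<^sub>2) * m / L"
  \<comment> \<open>A positive divisor whatever the sign of \<open>\<tau>max\<close>.\<close>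
  define T where "T = max \<tau>max 1"
  have \<tau>min: "\<tau>min > 0" using assms L by (simp add: \<tau>min_def)
  have T: "T > 0" by (simp add: T_def)
  have "\<sigma>\<^sub>1 * m / T * (norm (x (Suc k) - x k))\<^sup>2 \<le> \<phi> (x k) - \<phi> (x (Suc k)) \<and>
      norm (grad \<phi> (x k)) \<le> M / \<tau>min * norm (x (Suc k) - x k)" for k
  proof (cases "grad \<phi> (x k) = 0")
    case True
    then show ?thesis using step[of k] by (simp add: grnm_step_def)
  next
    case False
    with step[of k] obtain d \<tau> where d: "m * (norm d)\<^sup>2 \<le> (- grad \<phi> (x k)) \<bullet> d"
      "norm (grad \<phi> (x k)) \<le> M * norm d" and \<tau>: "0 < \<tau>" "\<tau> \<le> \<tau>max"
      and W: "wolfe \<phi> \<sigma>\<^sub>1 \<sigma>\<^sub>2 (x k) d \<tau>" and y: "x (Suc k) = x k + \<tau> *\<^sub>R d"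
      by (auto simp: grnm_step_def newton_direction_def)
    have "d \<noteq> 0" using d(2) False by auto
    then have nd: "norm d > 0" by simp
    have D: "norm (x (Suc k) - x k) = \<tau> * norm d" using \<tau> by (simp add: y)
    have "\<sigma>\<^sub>1 * m / T * (\<tau> * norm d)\<^sup>2 = \<sigma>\<^sub>1 * m * \<tau> * (norm d)\<^sup>2 * (\<tau> / T)"
      by (simp add: power2_eq_square)
    also have "\<dots> \<le> \<sigma>\<^sub>1 * m * \<tau> * (norm d)\<^sup>2 * 1"
      using \<tau> assms(2,5) T by (intro mult_left_mono) (auto simp: T_def)
    also have "\<dots> = \<sigma>\<^sub>1 * \<tau> * (m * (norm d)\<^sup>2)" by simp
    also have "\<dots> \<le> \<sigma>\<^sub>1 * \<tau> * ((- grad \<phi> (x k)) \<bullet> d)"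
      using d(1) assms(2) \<tau>(1) by (intro mult_left_mono) auto
    also have "\<dots> \<le> \<phi> (x k) - \<phi> (x (Suc k))" using W by (simp add: wolfe_def y)
    finally have 1: "\<sigma>\<^sub>1 * m / T * (norm (x (Suc k) - x k))\<^sup>2 \<le> \<phi> (x k) - \<phi> (x (Suc k))"
      by (simp add: D)
    have "(1 - \<sigma>\<^sub>2) * (m * (norm d)\<^sup>2) \<le> (1 - \<sigma>\<^sub>2) * ((- grad \<phi> (x k)) \<bullet> d)"
      using d(1) assms(3) by (intro mult_left_mono) auto
    also have "\<dots> \<le> (grad \<phi> (x (Suc k)) - grad \<phi> (x k)) \<bullet> d"
      using W by (simp add: wolfe_def y inner_diff_left algebra_simps)
    also have "\<dots> \<le> norm (grad \<phi> (x (Suc k)) - grad \<phi> (x k)) * norm d" by (rule norm_cauchy_schwarz)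
    \<comment> \<open>Only the two iterates are compared, and both lie in the level set, which need
      not be convex.\<close>
    also have "\<dots> \<le> L * (\<tau> * norm d) * norm d"
      using lipschitz_onD[OF L(2), of "x (Suc k)" "x k"] level D
      by (intro mult_right_mono) (auto simp: dist_norm)
    finally have "((1 - \<sigma>\<^sub>2) * m) * (norm d)\<^sup>2 \<le> (\<tau> * L) * (norm d)\<^sup>2"
      by (simp add: power2_eq_square mult_ac)
    then have "\<tau>min \<le> \<tau>" using nd L(1) by (simp add: \<tau>min_def pos_divide_le_eq)
    then have "M * (\<tau>min * norm d) \<le> M * (\<tau> * norm d)"
      using assms(5,6) by (intro mult_left_mono mult_right_mono) auto
    then have "M * norm d \<le> M / \<tau>min * (\<tau> * norm d)" using \<tau>min by (simp add: field_simps)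
    then have "norm (grad \<phi> (x k)) \<le> M / \<tau>min * norm (x (Suc k) - x k)" using d(2) by (simp add: D)
    with 1 show ?thesis by simp
  qed
  then show thesis
    using assms \<tau>min T by (intro that[of "\<sigma>\<^sub>1 * m / T" "M / \<tau>min"]) auto
qed

text \<open>The tangent inequality for a concave function, extended to the endpoint
  \<open>t = 0\<close>, which lies outside the interval of concavity.\<close>

lemma desingularizing_diff_ge:
  assumes \<psi>: "desingularizing \<eta> \<psi>" and "0 \<le> t" "t \<le> s" "0 < s" "ereal s < \<eta>"
  shows "deriv \<psi> s * (s - t) \<le> \<psi> s - \<psi> t"
proof -
  let ?I = "{s. 0 < s \<and> ereal s < \<eta>}"
  have op: "open ?I"
  proof (cases \<eta>)
    case (real e)
    then have "?I = {0<..<e}" by auto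
    then show ?thesis by simp
  next
    case PInf
    then have "?I = {0<..}" by auto
    then show ?thesis by simp
  qed (use assms in auto)
  have conn: "connected ?I"
    unfolding connected_iff_interval by (auto intro: order_le_less_trans[of "ereal _" "ereal _"])
  have s: "s \<in> ?I" using assms by simp
  have "\<psi> differentiable (at s)"
    using \<psi> s op by (auto simp: desingularizing_def differentiable_on_eq_differentiable_at)
  then have "(\<psi> has_real_derivative deriv \<psi> s) (at s)"
    by (simp add: DERIV_deriv_iff_real_differentiable)
  then have der: "((\<lambda>s. - \<psi> s) has_real_derivative - deriv \<psi> s) (at s within ?I)"
    by (intro DERIV_subset[OF DERIV_minus]) auto
  have pos: "deriv \<psi> s * (s - u) \<le> \<psi> s - \<psi> u" if "0 < u" "u \<le> s" for u
  proof -
    have "ereal u \<le> ereal s" using that by simp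
    then have "u \<in> ?I" using that(1) assms(5) order_le_less_trans by blast
    then have "- deriv \<psi> s * (u - s) \<le> - \<psi> u - - \<psi> s"
      using \<psi> conn s op der
      by (intro convex_on_imp_above_tangent[of ?I]) (auto simp: desingularizing_def concave_on_def interior_open)
    then show ?thesis by (simp add: algebra_simps)
  qed
  show ?thesis
  proof (cases "t = 0")
    case True
    \<comment> \<open>Since \<open>\<psi>\<close> may jump at 0, its value at \<open>u\<close> is
      dropped by nonnegativity before \<open>u\<close> tends to 0.\<close>
    have "((\<lambda>u. deriv \<psi> s * (s - u)) \<longlongrightarrow> deriv \<psi> s * (s - 0)) (at_right 0)"
      by (intro tendsto_intros)
    moreover have "\<forall>\<^sub>F u in at_right 0. deriv \<psi> s * (s - u) \<le> \<psi> s"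
      unfolding eventually_at_right_field
    proof (intro exI[of _ s] conjI allI impI)
      fix u assume u: "0 < u" "u < s"
      then have "ereal u < \<eta>" using assms(5) order_less_trans[of "ereal u" "ereal s" \<eta>] by simp
      then have "0 \<le> \<psi> u" using u \<psi> by (simp add: desingularizing_def)
      then show "deriv \<psi> s * (s - u) \<le> \<psi> s" using pos[of u] u by simp
    qed (use assms in simp)
    ultimately have "deriv \<psi> s * (s - 0) \<le> \<psi> s"
      by (rule tendsto_upperbound) simp
    then show ?thesis using True \<psi> by (simp add: desingularizing_def)
  qed (use pos assms in auto)
qed

text \<open>All that the convergence analysis retains of the algorithm. Decrease and gradient bound
  refer to the same step length, so they can be multiplied within one step.\<close>

locale descent_sequence =
  fixes \<phi> :: "'a::euclidean_space \<Rightarrow> real" and x :: "nat \<Rightarrow> 'a" and a b :: real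
  assumes continuous_phi: "continuous_on UNIV \<phi>"
    and continuous_grad: "continuous_on UNIV (grad \<phi>)"
    and a_pos: "0 < a" and b_pos: "0 < b"
    and decrease: "\<And>k. a * (norm (x (Suc k) - x k))\<^sup>2 \<le> \<phi> (x k) - \<phi> (x (Suc k))"
    and error_bound: "\<And>k. norm (grad \<phi> (x k)) \<le> b * norm (x (Suc k) - x k)"
begin

section \<open>Monotone values and cluster points\<close>

lemma phi_Suc_le: "\<phi> (x (Suc k)) \<le> \<phi> (x k)"
proof -
  have "0 \<le> a * (norm (x (Suc k) - x k))\<^sup>2" using a_pos by simp
  then show ?thesis using decrease[of k] by linarith
qed

lemma decseq_phi: "decseq (\<lambda>k. \<phi> (x k))"
  by (rule decseq_SucI) (rule phi_Suc_le)

text \<open>A cluster point is fixed first. Once convergence is known, the results are reused with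
  the identity as subsequence.\<close>

context
  fixes xbar \<rho>
  assumes subseq: "strict_mono \<rho>" "(x \<circ> \<rho>) \<longlonglongrightarrow> xbar"
begin

lemma phi_subseq_tendsto: "(\<lambda>k. \<phi> (x (\<rho> k))) \<longlonglongrightarrow> \<phi> xbar"
  using continuous_on_tendsto_compose[OF continuous_phi subseq(2)] by (simp add: comp_def)

lemma phi_cluster_le: "\<phi> xbar \<le> \<phi> (x k)"
proof (rule tendsto_upperbound[OF phi_subseq_tendsto])
  show "\<forall>\<^sub>F i in sequentially. \<phi> (x (\<rho> i)) \<le> \<phi> (x k)"
    using eventually_ge_at_top[of k]
  proof eventually_elim
    case (elim i)
    then have "k \<le> \<rho> i" using seq_suble[OF subseq(1), of i] by simp
    then show ?case using decseqD[OF decseq_phi] by blast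
  qed
qed simp

lemma phi_tendsto: "(\<lambda>k. \<phi> (x k)) \<longlonglongrightarrow> \<phi> xbar"
proof -
  obtain l where l: "(\<lambda>k. \<phi> (x k)) \<longlonglongrightarrow> l"
    using decseq_convergent[OF decseq_phi, of "\<phi> xbar"] phi_cluster_le by blast
  then have "(\<lambda>k. \<phi> (x (\<rho> k))) \<longlonglongrightarrow> l"
    using LIMSEQ_subseq_LIMSEQ[OF l subseq(1)] by (simp add: comp_def)
  then show ?thesis using l LIMSEQ_unique[OF _ phi_subseq_tendsto] by blast
qed

lemma step_tendsto_0: "(\<lambda>k. norm (x (Suc k) - x k)) \<longlonglongrightarrow> 0"
proof -
  have "(\<lambda>k. (\<phi> (x k) - \<phi> (x (Suc k))) / a) \<longlonglongrightarrow> (\<phi> xbar - \<phi> xbar) / a"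
    using a_pos by (intro tendsto_intros phi_tendsto LIMSEQ_Suc) auto
  then have lim: "(\<lambda>k. (\<phi> (x k) - \<phi> (x (Suc k))) / a) \<longlonglongrightarrow> 0" by simp
  have "(\<lambda>k. (norm (x (Suc k) - x k))\<^sup>2) \<longlonglongrightarrow> 0"
  proof (rule Lim_null_comparison[OF _ lim])
    show "\<forall>\<^sub>F k in sequentially. norm ((norm (x (Suc k) - x k))\<^sup>2) \<le> (\<phi> (x k) - \<phi> (x (Suc k))) / a"
      using decrease a_pos by (simp add: pos_le_divide_eq mult.commute)
  qed
  from tendsto_real_sqrt[OF this] show ?thesis by simp
qed

lemma grad_cluster_eq_0: "grad \<phi> xbar = 0"
proof -
  have "(\<lambda>k. b * norm (x (Suc k) - x k)) \<longlonglongrightarrow> 0"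
    using tendsto_mult_right_zero[OF step_tendsto_0] .
  then have "(\<lambda>k. grad \<phi> (x k)) \<longlonglongrightarrow> 0"
    by (rule Lim_null_comparison[rotated]) (simp add: error_bound)
  then have "(\<lambda>k. grad \<phi> (x (\<rho> k))) \<longlonglongrightarrow> 0"
    using LIMSEQ_subseq_LIMSEQ[OF _ subseq(1)] by (auto simp: comp_def)
  moreover have "(\<lambda>k. grad \<phi> (x (\<rho> k))) \<longlonglongrightarrow> grad \<phi> xbar"
    using continuous_on_tendsto_compose[OF continuous_grad subseq(2)] by (simp add: comp_def)
  ultimately show ?thesis using LIMSEQ_unique by blast
qed

text \<open>The KL inequality is silent on the level of \<open>xbar\<close>; there the decrease
  condition itself makes the sequence stationary.\<close>

lemma step_eq_0_if_phi_eq: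
  assumes "\<phi> (x k) = \<phi> xbar"
  shows "x (Suc k) = x k" "\<phi> (x (Suc k)) = \<phi> xbar"
proof -
  have "a * (norm (x (Suc k) - x k))\<^sup>2 \<le> 0" using decrease[of k] phi_cluster_le[of "Suc k"] assms by simp
  then show "x (Suc k) = x k" using a_pos by (simp add: mult_le_0_iff)
  then show "\<phi> (x (Suc k)) = \<phi> xbar" using assms by simp
qed

text \<open>With step length \<open>D\<close>, gap \<open>s\<close> and next gap \<open>t\<close>:
  KL and the gradient bound give \<open>1 \<le> deriv \<psi> s * (b * D)\<close>. Multiplying by
  \<open>a / b * D\<close> creates \<open>a * D\<^sup>2\<close>, which the decrease bounds by
  \<open>s - t\<close>; the tangent inequality finishes.\<close>

lemma step_le_desingularizing_diff:
  assumes KL: "KL_with \<phi> xbar \<eta> U \<psi>" and "x k \<in> U" "ereal (\<phi> (x k) - \<phi> xbar) < \<eta>"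
  shows "a / b * norm (x (Suc k) - x k) \<le> \<psi> (\<phi> (x k) - \<phi> xbar) - \<psi> (\<phi> (x (Suc k)) - \<phi> xbar)"
proof (cases "\<phi> (x k) = \<phi> xbar")
  case True
  then show ?thesis using step_eq_0_if_phi_eq by simp
next
  case False
  define s where "s = \<phi> (x k) - \<phi> xbar"
  define t where "t = \<phi> (x (Suc k)) - \<phi> xbar"
  define D where "D = norm (x (Suc k) - x k)"
  have s: "s > 0" "ereal s < \<eta>" and t: "0 \<le> t" "t \<le> s"
    using False phi_cluster_le[of k] phi_cluster_le[of "Suc k"] phi_Suc_le[of k] assms(3)
    by (auto simp: s_def t_def)
  have "\<phi> (x k) = \<phi> xbar + s" by (simp add: s_def)
  then have "ereal (\<phi> (x k)) < ereal (\<phi> xbar) + \<eta>"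
    using s(2) by (cases \<eta>) auto
  then have g: "1 \<le> deriv \<psi> s * norm (grad \<phi> (x k))"
    using KL assms(2) s by (auto simp: KL_with_def s_def)
  have \<psi>: "desingularizing \<eta> \<psi>" using KL by (simp add: KL_with_def)
  then have p: "deriv \<psi> s > 0" using s by (simp add: desingularizing_def)
  have "deriv \<psi> s * norm (grad \<phi> (x k)) \<le> deriv \<psi> s * (b * D)"
    using error_bound p unfolding D_def by (intro mult_left_mono) auto
  with g have "1 * (a / b * D) \<le> deriv \<psi> s * (b * D) * (a / b * D)"
    using a_pos b_pos by (intro mult_right_mono) (auto simp: D_def)
  also have "\<dots> = deriv \<psi> s * (a * D\<^sup>2)" using b_pos by (simp add: power2_eq_square)
  also have "\<dots> \<le> deriv \<psi> s * (s - t)"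
    using decrease[of k] p by (intro mult_left_mono) (auto simp: D_def s_def t_def)
  also have "\<dots> \<le> \<psi> s - \<psi> t" using desingularizing_diff_ge[OF \<psi> t s] .
  finally show ?thesis by (simp add: s_def t_def D_def)
qed

text \<open>Membership in \<open>U\<close> is required only for \<open>j < n\<close>, so the bound
  can help to prove it for index \<open>n\<close>.\<close>

lemma steps_le_desingularizing_diff:
  assumes "KL_with \<phi> xbar \<eta> U \<psi>"
    and "\<And>j. j < n \<Longrightarrow> x (k + j) \<in> U" "ereal (\<phi> (x k) - \<phi> xbar) < \<eta>"
  shows "(\<Sum>j<n. norm (x (Suc (k + j)) - x (k + j)))
    \<le> b / a * (\<psi> (\<phi> (x k) - \<phi> xbar) - \<psi> (\<phi> (x (k + n)) - \<phi> xbar))"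
  using assms(2)
proof (induction n)
  case (Suc n)
  have "\<phi> (x (k + n)) \<le> \<phi> (x k)" using decseqD[OF decseq_phi, of k "k + n"] by simp
  then have "ereal (\<phi> (x (k + n)) - \<phi> xbar) < \<eta>"
    using assms(3) by (meson diff_right_mono ereal_less_eq(3) order_le_less_trans)
  then have "a / b * norm (x (Suc (k + n)) - x (k + n))
      \<le> \<psi> (\<phi> (x (k + n)) - \<phi> xbar) - \<psi> (\<phi> (x (Suc (k + n))) - \<phi> xbar)"
    by (intro step_le_desingularizing_diff[OF assms(1)] Suc.prems) auto
  then have "b / a * (a / b * norm (x (Suc (k + n)) - x (k + n)))
      \<le> b / a * (\<psi> (\<phi> (x (k + n)) - \<phi> xbar) - \<psi> (\<phi> (x (Suc (k + n))) - \<phi> xbar))"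
    using a_pos b_pos by (intro mult_left_mono) auto
  then have "norm (x (Suc (k + n)) - x (k + n))
      \<le> b / a * (\<psi> (\<phi> (x (k + n)) - \<phi> xbar) - \<psi> (\<phi> (x (Suc (k + n))) - \<phi> xbar))"
    using a_pos b_pos by simp
  moreover have "(\<Sum>j<n. norm (x (Suc (k + j)) - x (k + j)))
    \<le> b / a * (\<psi> (\<phi> (x k) - \<phi> xbar) - \<psi> (\<phi> (x (k + n)) - \<phi> xbar))"
    using Suc by auto
  ultimately show ?case by (simp add: right_diff_distrib)
qed simp

lemma eventually_gap_less:
  assumes "0 < \<eta>"
  shows "\<forall>\<^sub>F k in sequentially. ereal (\<phi> (x k) - \<phi> xbar) < \<eta>"
proof -
  have "(\<lambda>k. ereal (\<phi> (x k) - \<phi> xbar)) \<longlonglongrightarrow> ereal (\<phi> xbar - \<phi> xbar)"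
    by (intro tendsto_intros phi_tendsto)
  then show ?thesis using assms by (intro order_tendstoD(2)) (auto simp: zero_ereal_def)
qed

text \<open>The values \<open>\<psi> (\<phi> (x k) - \<phi> xbar)\<close> decrease and are nonnegative, hence Cauchy, even if \<open>\<psi>\<close>
  is discontinuous at \<open>0\<close>. Their small oscillation keeps the sequence in a ball around \<open>xbar\<close>.\<close>

lemma summable_steps:
  assumes "KL_at \<phi> xbar"
  shows "summable (\<lambda>k. norm (x (Suc k) - x k))"
proof -
  from assms obtain \<eta> U \<psi> where KL: "KL_with \<phi> xbar \<eta> U \<psi>" by (auto simp: KL_at_def)
  then have \<eta>: "0 < \<eta>" and U: "open U" "xbar \<in> U" and \<psi>: "desingularizing \<eta> \<psi>"
    by (auto simp: KL_with_def)
  obtain e where e: "e > 0" "ball xbar e \<subseteq> U" using U openE by blast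
  define v where "v k = \<psi> (\<phi> (x k) - \<phi> xbar)" for k
  obtain k\<^sub>1 where k\<^sub>1: "\<And>k. k \<ge> k\<^sub>1 \<Longrightarrow> ereal (\<phi> (x k) - \<phi> xbar) < \<eta>"
    using eventually_gap_less[OF \<eta>] by (auto simp: eventually_sequentially)
  have v_nonneg: "0 \<le> v k" if "k \<ge> k\<^sub>1" for k
    using \<psi> k\<^sub>1[OF that] phi_cluster_le[of k] by (simp add: desingularizing_def v_def)
  \<comment> \<open>Derived from the tangent inequality alone, because membership of the iterates in
    \<open>U\<close> is not yet known.\<close>
  have "v (Suc k) \<le> v k" if k: "k \<ge> k\<^sub>1" for k
  proof (cases "\<phi> (x k) = \<phi> xbar")
    case True
    then show ?thesis using step_eq_0_if_phi_eq[OF True] by (simp add: v_def)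
  next
    case False
    define s where "s = \<phi> (x k) - \<phi> xbar"
    define t where "t = \<phi> (x (Suc k)) - \<phi> xbar"
    have s: "s > 0" "ereal s < \<eta>" and t: "0 \<le> t" "t \<le> s"
      using False phi_cluster_le[of k] phi_cluster_le[of "Suc k"] phi_Suc_le[of k] k\<^sub>1[OF k]
      by (auto simp: s_def t_def)
    have "0 < deriv \<psi> s" using \<psi> s by (simp add: desingularizing_def)
    then have "0 \<le> deriv \<psi> s * (s - t)" using t by simp
    also have "\<dots> \<le> \<psi> s - \<psi> t" by (rule desingularizing_diff_ge[OF \<psi> t s])
    finally show ?thesis by (simp add: v_def s_def t_def)
  qed
  then have "decseq (\<lambda>k. v (k + k\<^sub>1))" by (intro decseq_SucI) simp
  then obtain l where "(\<lambda>k. v (k + k\<^sub>1)) \<longlonglongrightarrow> l"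
    using decseq_convergent[of "\<lambda>k. v (k + k\<^sub>1)" 0] v_nonneg by (metis le_add2)
  then have "v \<longlonglongrightarrow> l" by (simp add: LIMSEQ_offset)
  then have "Cauchy v" by (rule LIMSEQ_imp_Cauchy)
  \<comment> \<open>This tolerance becomes \<open>e / 2\<close> after multiplication by
    \<open>b / a\<close>.\<close>
  moreover have "0 < a / b * (e / 2)" using e(1) a_pos b_pos by simp
  ultimately obtain k\<^sub>2 where k\<^sub>2: "\<And>i j. i \<ge> k\<^sub>2 \<Longrightarrow> j \<ge> k\<^sub>2 \<Longrightarrow> dist (v i) (v j) < a / b * (e / 2)"
    unfolding Cauchy_def by blast
  have "\<forall>\<^sub>F i in sequentially. dist ((x \<circ> \<rho>) i) xbar < e / 2"
    by (rule tendstoD[OF subseq(2)]) (use e(1) in simp)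
  then obtain i where i: "i \<ge> max k\<^sub>1 k\<^sub>2" "dist (x (\<rho> i)) xbar < e / 2"
    unfolding eventually_sequentially by (metis comp_apply max.cobounded1 max.cobounded2)
  define k where "k = \<rho> i"
  have k: "k \<ge> k\<^sub>1" "k \<ge> k\<^sub>2" "dist (x k) xbar < e / 2"
    using i seq_suble[OF subseq(1), of i] by (auto simp: k_def)
  have sums: "(\<Sum>j<n. norm (x (Suc (k + j)) - x (k + j))) < e / 2"
    if "\<And>j. j < n \<Longrightarrow> x (k + j) \<in> U" for n
  proof -
    have "(\<Sum>j<n. norm (x (Suc (k + j)) - x (k + j))) \<le> b / a * (v k - v (k + n))"
      unfolding v_def by (rule steps_le_desingularizing_diff[OF KL that k\<^sub>1[OF k(1)]])
    also have "v k - v (k + n) < a / b * (e / 2)"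
      using k\<^sub>2[OF k(2), of "k + n"] k(2) by (auto simp: dist_real_def)
    then have "b / a * (v k - v (k + n)) < b / a * (a / b * (e / 2))"
      using a_pos b_pos by (intro mult_strict_left_mono) auto
    also have "\<dots> = e / 2" using a_pos b_pos by simp
    finally show ?thesis .
  qed
  \<comment> \<open>Trapping argument: while the earlier iterates are in \<open>U\<close>, the path
    from \<open>x k\<close> is shorter than \<open>e / 2\<close>, and \<open>x k\<close> itself is
    within \<open>e / 2\<close> of \<open>xbar\<close>.\<close>
  have in_U: "x (k + n) \<in> U" for n
  proof (induction n rule: less_induct)
    case (less n)
    have "norm (x (k + n) - x k) = norm (\<Sum>j<n. x (Suc (k + j)) - x (k + j))"
      using sum_lessThan_telescope[of "\<lambda>j. x (k + j)" n] by simp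
    also have "\<dots> \<le> (\<Sum>j<n. norm (x (Suc (k + j)) - x (k + j)))" by (rule norm_sum)
    also have "\<dots> < e / 2" by (rule sums) (rule less)
    finally have "dist (x (k + n)) xbar < e"
      using k(3) dist_triangle[of "x (k + n)" xbar "x k"] by (simp add: dist_norm)
    then show ?case using e(2) by (auto simp: dist_commute)
  qed
  have "summable (\<lambda>j. norm (x (Suc (k + j)) - x (k + j)))"
  proof (rule summableI_nonneg_bounded)
    show "(\<Sum>j<n. norm (x (Suc (k + j)) - x (k + j))) \<le> e / 2" for n
      using sums[of n] in_U by (intro less_imp_le) auto
  qed simp
  then show ?thesis
    using summable_iff_shift[of "\<lambda>j. norm (x (Suc j) - x j)" k] by (simp add: add.commute)
qed

text \<open>Finite length makes the whole sequence converge, and its limit must be the cluster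
  point.\<close>

lemma tendsto_cluster:
  assumes "KL_at \<phi> xbar"
  shows "x \<longlonglongrightarrow> xbar"
proof -
  have "summable (\<lambda>k. x (Suc k) - x k)"
    using summable_steps[OF assms] by (rule summable_norm_cancel)
  then have "convergent (\<lambda>n. \<Sum>k<n. x (Suc k) - x k)" by (simp add: summable_iff_convergent)
  then have "convergent (\<lambda>n. x n - x 0)" by (simp add: sum_lessThan_telescope)
  then obtain l where "(\<lambda>n. x n - x 0) \<longlonglongrightarrow> l" by (auto simp: convergent_def)
  from tendsto_add[OF this tendsto_const[of "x 0"]] have l: "x \<longlonglongrightarrow> l + x 0" by simp
  then have "(x \<circ> \<rho>) \<longlonglongrightarrow> l + x 0" by (rule LIMSEQ_subseq_LIMSEQ[OF _ subseq(1)])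
  then show ?thesis using LIMSEQ_unique[OF subseq(2)] l by blast
qed

end

section \<open>Convergence of the whole sequence and tail estimates\<close>

lemma KL_convergence:
  assumes "bounded (range x)" "KL_function \<phi>"
  shows "summable (\<lambda>k. norm (x (Suc k) - x k)) \<and> (\<exists>xbar. x \<longlonglongrightarrow> xbar \<and> grad \<phi> xbar = 0)"
proof -
  obtain xbar \<rho> where \<rho>: "strict_mono \<rho>" "(x \<circ> \<rho>) \<longlonglongrightarrow> xbar"
    using bounded_imp_convergent_subsequence[OF assms(1)] by blast
  have KL: "KL_at \<phi> xbar" using assms(2) by (simp add: KL_function_def)
  show ?thesis
    using summable_steps[OF \<rho> KL] tendsto_cluster[OF \<rho> KL] grad_cluster_eq_0[OF \<rho>] by blast
qed

lemma norm_diff_limit_le_tail: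
  assumes "x \<longlonglongrightarrow> xbar" "summable (\<lambda>k. norm (x (Suc k) - x k))"
  shows "norm (x k - xbar) \<le> (\<Sum>j. norm (x (Suc (k + j)) - x (k + j)))"
proof -
  have sm: "summable (\<lambda>j. norm (x (Suc (k + j)) - x (k + j)))"
    using summable_iff_shift[of "\<lambda>j. norm (x (Suc j) - x j)" k] assms(2) by (simp add: add.commute)
  have "(\<lambda>n. norm (x (n + k) - x k)) \<longlonglongrightarrow> norm (xbar - x k)"
    by (intro tendsto_intros LIMSEQ_ignore_initial_segment assms(1))
  moreover have "norm (x (n + k) - x k) \<le> (\<Sum>j. norm (x (Suc (k + j)) - x (k + j)))" for n
  proof -
    have "norm (x (n + k) - x k) = norm (\<Sum>j<n. x (Suc (k + j)) - x (k + j))"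
      using sum_lessThan_telescope[of "\<lambda>j. x (k + j)" n] by (simp add: add.commute)
    also have "\<dots> \<le> (\<Sum>j<n. norm (x (Suc (k + j)) - x (k + j)))" by (rule norm_sum)
    also have "\<dots> \<le> (\<Sum>j. norm (x (Suc (k + j)) - x (k + j)))" by (intro sum_le_suminf sm) auto
    finally show ?thesis .
  qed
  ultimately have "norm (xbar - x k) \<le> (\<Sum>j. norm (x (Suc (k + j)) - x (k + j)))"
    by (intro LIMSEQ_le_const2) auto
  then show ?thesis by (simp add: norm_minus_commute)
qed

text \<open>The tail bound is the telescoped estimate with its last, nonnegative term dropped. The
  gap recursion squares \<open>s powr \<theta> \<le> E * norm (grad \<phi> (x k))\<close>, bounds
  the gradient by the step length, and uses the decrease.\<close>

lemma KL_exponent_tail_and_gap: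
  assumes lim: "x \<longlonglongrightarrow> xbar" and sm: "summable (\<lambda>k. norm (x (Suc k) - x k))"
    and KL: "KL_exponent_at \<theta> \<phi> xbar"
  obtains B c where "0 < B" "0 < c"
    "\<forall>\<^sub>F k in sequentially.
       (\<Sum>j. norm (x (Suc (k + j)) - x (k + j))) \<le> B * (\<phi> (x k) - \<phi> xbar) powr (1 - \<theta>) \<and>
       c * (\<phi> (x k) - \<phi> xbar) powr (2 * \<theta>) \<le> \<phi> (x k) - \<phi> (x (Suc k))"
proof -
  have \<rho>: "strict_mono (\<lambda>k::nat. k)" "(x \<circ> (\<lambda>k. k)) \<longlonglongrightarrow> xbar"
    using lim by (auto simp: strict_mono_def comp_def)
  from KL obtain \<eta> U C where C: "C > 0" and KLw: "KL_with \<phi> xbar \<eta> U (\<lambda>s. C * s powr (1 - \<theta>))"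
    by (auto simp: KL_exponent_at_def)
  then have \<eta>: "0 < \<eta>" and U: "open U" "xbar \<in> U" by (auto simp: KL_with_def)
  obtain E h where E: "0 < E" "0 < h" "\<forall>\<^sub>F y in nhds xbar. \<phi> xbar < \<phi> y \<and> \<phi> y < \<phi> xbar + h
      \<longrightarrow> (\<phi> y - \<phi> xbar) powr \<theta> \<le> E * norm (grad \<phi> y)"
    using KL by (rule KL_exponent_atE)
  have "\<forall>\<^sub>F k in sequentially. \<phi> xbar < \<phi> (x k) \<and> \<phi> (x k) < \<phi> xbar + h
      \<longrightarrow> (\<phi> (x k) - \<phi> xbar) powr \<theta> \<le> E * norm (grad \<phi> (x k))"
    using E(3) lim by (rule eventually_compose_filterlim)
  moreover have "\<forall>\<^sub>F k in sequentially. \<phi> (x k) < \<phi> xbar + h"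
    using phi_tendsto[OF \<rho>] E(2) by (intro order_tendstoD(2)) auto
  ultimately have 2: "\<forall>\<^sub>F k in sequentially. a / (E * b)\<^sup>2 * (\<phi> (x k) - \<phi> xbar) powr (2 * \<theta>) \<le> \<phi> (x k) - \<phi> (x (Suc k))"
  proof eventually_elim
    case (elim k)
    define s where "s = \<phi> (x k) - \<phi> xbar"
    have "s powr \<theta> \<le> E * norm (grad \<phi> (x k))"
    \<comment> \<open>At \<open>s = 0\<close> the KL inequality says nothing, but
      \<open>0 powr \<theta> = 0\<close>.\<close>
    proof (cases "s = 0")
      case False
      then show ?thesis using elim phi_cluster_le[OF \<rho>, of k] by (auto simp: s_def)
    qed (use E in simp)
    also have "\<dots> \<le> E * (b * norm (x (Suc k) - x k))"
      using error_bound E(1) by (intro mult_left_mono) auto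
    finally have "(s powr \<theta>)\<^sup>2 \<le> (E * (b * norm (x (Suc k) - x k)))\<^sup>2"
      by (rule power_mono) simp
    moreover have "(s powr \<theta>)\<^sup>2 = s powr (2 * \<theta>)"
      by (simp add: power2_eq_square flip: powr_add)
    ultimately have "s powr (2 * \<theta>) \<le> (E * b)\<^sup>2 * (norm (x (Suc k) - x k))\<^sup>2"
      by (simp add: power_mult_distrib)
    then have "a / (E * b)\<^sup>2 * s powr (2 * \<theta>) \<le> a / (E * b)\<^sup>2 * ((E * b)\<^sup>2 * (norm (x (Suc k) - x k))\<^sup>2)"
      using a_pos by (intro mult_left_mono) auto
    also have "\<dots> = a * (norm (x (Suc k) - x k))\<^sup>2" using E(1) b_pos by simp
    also have "\<dots> \<le> \<phi> (x k) - \<phi> (x (Suc k))" by (rule decrease)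
    finally show ?case by (simp add: s_def)
  qed
  have "\<forall>\<^sub>F k in sequentially. x k \<in> U" using lim U by (rule topological_tendstoD)
  then have "\<forall>\<^sub>F k in sequentially. \<forall>j\<ge>k. x j \<in> U" by (rule eventually_all_ge_at_top)
  with eventually_gap_less[OF \<rho> \<eta>]
  have 1: "\<forall>\<^sub>F k in sequentially. (\<Sum>j. norm (x (Suc (k + j)) - x (k + j)))
      \<le> b / a * C * (\<phi> (x k) - \<phi> xbar) powr (1 - \<theta>)"
  proof eventually_elim
    case (elim k)
    show ?case
    proof (rule suminf_le_const)
      show "summable (\<lambda>j. norm (x (Suc (k + j)) - x (k + j)))"
        using summable_iff_shift[of "\<lambda>j. norm (x (Suc j) - x j)" k] sm by (simp add: add.commute)
      fix n
      have "(\<Sum>j<n. norm (x (Suc (k + j)) - x (k + j)))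
        \<le> b / a * (C * (\<phi> (x k) - \<phi> xbar) powr (1 - \<theta>) - C * (\<phi> (x (k + n)) - \<phi> xbar) powr (1 - \<theta>))"
        using elim by (intro steps_le_desingularizing_diff[OF \<rho> KLw]) auto
      also have "\<dots> \<le> b / a * (C * (\<phi> (x k) - \<phi> xbar) powr (1 - \<theta>))"
        using a_pos b_pos C by (intro mult_left_mono) auto
      finally show "(\<Sum>j<n. norm (x (Suc (k + j)) - x (k + j))) \<le> b / a * C * (\<phi> (x k) - \<phi> xbar) powr (1 - \<theta>)"
        by simp
    qed
  qed
  show thesis
  proof (rule that)
    show "0 < b / a * C" "0 < a / (E * b)\<^sup>2" using a_pos b_pos C E(1) by auto
    show "\<forall>\<^sub>F k in sequentially. (\<Sum>j. norm (x (Suc (k + j)) - x (k + j)))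
        \<le> b / a * C * (\<phi> (x k) - \<phi> xbar) powr (1 - \<theta>) \<and>
      a / (E * b)\<^sup>2 * (\<phi> (x k) - \<phi> xbar) powr (2 * \<theta>) \<le> \<phi> (x k) - \<phi> (x (Suc k))"
      using 1 2 by eventually_elim simp
  qed
qed

end

section \<open>Convergence rates\<close>

lemma geometric_decay:
  fixes r :: "nat \<Rightarrow> real"
  assumes nonneg: "\<And>k. 0 \<le> r k" and c: "0 < c"
    and dec: "\<forall>\<^sub>F k in sequentially. c * r k \<le> r k - r (Suc k)"
  shows "\<exists>A>0. \<exists>q. 0 < q \<and> q < 1 \<and> (\<forall>\<^sub>F k in sequentially. r k \<le> A * q ^ k)"
proof -
  obtain K where K: "\<And>k. k \<ge> K \<Longrightarrow> c * r k \<le> r k - r (Suc k)"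
    using dec by (auto simp: eventually_sequentially)
  \<comment> \<open>Since \<open>1 - c\<close> may be nonpositive, the maximum keeps
    \<open>q\<close> positive and division by \<open>q ^ K\<close> valid.\<close>
  define q where "q = max (1 - c) (1/2)"
  have q: "0 < q" "q < 1" using c by (auto simp: q_def)
  define A where "A = r K / q ^ K + 1"
  have A: "A > 0" using nonneg[of K] q by (simp add: A_def add_nonneg_pos)
  have "r k \<le> A * q ^ k" if "k \<ge> K" for k
    using that
  proof (induction k rule: dec_induct)
    case base
    have "r K = r K / q ^ K * q ^ K" using q by simp
    also have "\<dots> \<le> A * q ^ K" using q by (intro mult_right_mono) (auto simp: A_def)
    finally show ?case .
  next
    case (step k)
    have "r (Suc k) \<le> (1 - c) * r k" using K[of k] step by (simp add: algebra_simps)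
    also have "\<dots> \<le> q * r k" using nonneg by (intro mult_right_mono) (auto simp: q_def)
    also have "\<dots> \<le> q * (A * q ^ k)" using step q by (intro mult_left_mono) auto
    finally show ?case by (simp add: mult_ac)
  qed
  then have "\<forall>\<^sub>F k in sequentially. r k \<le> A * q ^ k" by (auto simp: eventually_sequentially)
  with A q show ?thesis by blast
qed

text \<open>The quantity \<open>r k powr - p\<close> grows by at least \<open>p * c\<close> in every step.\<close>

lemma sublinear_decay:
  fixes r :: "nat \<Rightarrow> real"
  assumes nonneg: "\<And>k. 0 \<le> r k" and c: "0 < c" and p: "0 < p"
    and dec: "\<forall>\<^sub>F k in sequentially. c * r k powr (1 + p) \<le> r k - r (Suc k)"
  shows "\<exists>A>0. \<forall>\<^sub>F k in sequentially. r k \<le> A * real k powr (- 1 / p)"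
proof -
  obtain K where K: "\<And>k. k \<ge> K \<Longrightarrow> c * r k powr (1 + p) \<le> r k - r (Suc k)"
    using dec by (auto simp: eventually_sequentially)
  have step: "r (Suc k) powr - p \<ge> r k powr - p + p * c" if k: "k \<ge> K" and pos: "r (Suc k) > 0" for k
  proof -
    have rk: "r k > 0"
    proof (rule ccontr)
      assume "\<not> r k > 0"
      then have "r k = 0" using nonneg[of k] by simp
      then show False using K[OF k] pos p by simp
    qed
    then have "0 < c * r k powr (1 + p)" using c by simp
    then have lt: "r (Suc k) < r k" using K[OF k] by simp
    have "((\<lambda>t. t powr - p) has_real_derivative - p * t powr (- p - 1)) (at t)" if "t > 0" for t :: real
      using that by (auto intro!: derivative_eq_intros)
    then obtain \<xi> where \<xi>: "r (Suc k) < \<xi>" "\<xi> < r k"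
      "r k powr - p - r (Suc k) powr - p = (r k - r (Suc k)) * (- p * \<xi> powr (- p - 1))"
      using MVT2[of "r (Suc k)" "r k" "\<lambda>t. t powr - p" "\<lambda>t. - p * t powr (- p - 1)"] lt pos by auto
    \<comment> \<open>The exponent is negative, so the intermediate point below \<open>r k\<close>
      has the larger power.\<close>
    have "r k powr (- p - 1) \<le> \<xi> powr (- p - 1)"
      using \<xi> pos p by (intro powr_mono2') auto
    then have "(r k - r (Suc k)) * (p * r k powr (- p - 1)) \<le> (r k - r (Suc k)) * (p * \<xi> powr (- p - 1))"
      using lt p by (intro mult_left_mono) auto
    moreover have "c * r k powr (1 + p) * (p * r k powr (- p - 1)) \<le> (r k - r (Suc k)) * (p * r k powr (- p - 1))"
      using K[OF k] p by (intro mult_right_mono) auto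
    moreover have "c * r k powr (1 + p) * (p * r k powr (- p - 1)) = p * c * (r k powr (1 + p) * r k powr (- p - 1))"
      by simp
    moreover have "r k powr (1 + p) * r k powr (- p - 1) = 1" using rk by (simp flip: powr_add)
    ultimately show ?thesis using \<xi>(3) by simp
  qed
  \<comment> \<open>Positivity is part of the claim because \<open>0 powr - p = 0\<close>, which
    would break the growth once the gap vanishes.\<close>
  have grow: "p * c * real n \<le> r (K + n) powr - p" if "r (K + n) > 0" for n
    using that
  proof (induction n)
    case (Suc n)
    have "r (K + n) > 0"
    proof (rule ccontr)
      assume "\<not> r (K + n) > 0"
      then have "r (K + n) = 0" using nonneg[of "K + n"] by simp
      then show False using K[of "K + n"] Suc.prems p by simp
    qed
    with Suc have "p * c * real n \<le> r (K + n) powr - p" by simp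
    then show ?case using step[of "K + n"] Suc.prems by (simp add: algebra_simps)
  qed simp
  define A where "A = (p * c / 2) powr (- 1 / p)"
  have A: "A > 0" using p c by (simp add: A_def)
  \<comment> \<open>For these \<open>k\<close> the count \<open>k - K\<close> is at least
    \<open>k / 2\<close>, whence the factor 1/2 in \<open>A\<close>; the summand 1 keeps
    \<open>k\<close> positive.\<close>
  have "r k \<le> A * real k powr (- 1 / p)" if k: "k \<ge> 2 * K + 1" for k
  proof (cases "r k = 0")
    case False
    then have rk: "r k > 0" using nonneg[of k] by simp
    have "p * c / 2 * real k \<le> p * c * real (k - K)"
      using k p c by (simp add: field_simps)
    also have "\<dots> \<le> r k powr - p" using grow[of "k - K"] k rk by simp
    finally have "(r k powr - p) powr (- 1 / p) \<le> (p * c / 2 * real k) powr (- 1 / p)"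
      using p c k by (intro powr_mono2') auto
    also have "(r k powr - p) powr (- 1 / p) = r k" using rk p by (simp add: powr_powr)
    finally show ?thesis by (simp only: A_def powr_mult)
  qed (use A in simp)
  then have "\<forall>\<^sub>F k in sequentially. r k \<le> A * real k powr (- 1 / p)"
    unfolding eventually_sequentially by blast
  with A show ?thesis by blast
qed

text \<open>The finitely many early indices are absorbed by adding their ratios to the constant.
  Index 0 is excluded because \<open>real 0 powr s = 0\<close> leaves no positive comparison value
  there.\<close>

lemma ex_bound_if_eventually_bound:
  fixes f g :: "nat \<Rightarrow> real"
  assumes "\<And>k. k \<ge> 1 \<Longrightarrow> 0 < g k" "0 < \<gamma>" "\<forall>\<^sub>F k in sequentially. f k \<le> \<gamma> * g k"
  shows "\<exists>\<gamma>>0. \<forall>k\<ge>1. f k \<le> \<gamma> * g k"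
proof -
  obtain K where K: "\<And>k. k \<ge> K \<Longrightarrow> f k \<le> \<gamma> * g k"
    using assms(3) by (auto simp: eventually_sequentially)
  define S where "S = (\<Sum>k<K. \<bar>f k / g k\<bar>)"
  have S: "S \<ge> 0" by (simp add: S_def sum_nonneg)
  have "f k \<le> (\<gamma> + S) * g k" if k: "k \<ge> 1" for k
  proof (cases "k \<ge> K")
    case True
    then have "f k \<le> \<gamma> * g k" by (rule K)
    also have "\<dots> \<le> (\<gamma> + S) * g k" using S assms(1)[OF k] by (intro mult_right_mono) auto
    finally show ?thesis .
  next
    case False
    then have "\<bar>f k / g k\<bar> \<le> S" unfolding S_def by (intro member_le_sum) auto
    then have "f k / g k \<le> \<gamma> + S" using assms(2) by linarith
    then show ?thesis using assms(1)[OF k] by (simp add: pos_divide_le_eq)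
  qed
  then show ?thesis using S assms(2) by (intro exI[of _ "\<gamma> + S"]) auto
qed

section \<open>Rates for the tails of a descent sequence\<close>

context descent_sequence
begin

text \<open>Here \<open>2 * \<theta> = 1\<close>, so the gap decays geometrically; the tail is
  bounded by its square root, which replaces \<open>q\<close> by \<open>sqrt q\<close>.\<close>

lemma KL_exponent_half_rate:
  assumes lim: "x \<longlonglongrightarrow> xbar" and sm: "summable (\<lambda>k. norm (x (Suc k) - x k))"
    and KL: "KL_exponent_at (1/2) \<phi> xbar"
  shows "\<exists>\<gamma>>0. \<exists>q. 0 < q \<and> q < 1 \<and>
    (\<forall>\<^sub>F k in sequentially. (\<Sum>j. norm (x (Suc (k + j)) - x (k + j))) \<le> \<gamma> * q ^ k)"
proof -
  have \<rho>: "strict_mono (\<lambda>k::nat. k)" "(x \<circ> (\<lambda>k. k)) \<longlonglongrightarrow> xbar"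
    using lim by (auto simp: strict_mono_def comp_def)
  define r where "r k = \<phi> (x k) - \<phi> xbar" for k
  have nonneg: "r k \<ge> 0" for k using phi_cluster_le[OF \<rho>, of k] by (simp add: r_def)
  obtain B c where B: "0 < B" and c: "0 < c"
    and ev: "\<forall>\<^sub>F k in sequentially. (\<Sum>j. norm (x (Suc (k + j)) - x (k + j))) \<le> B * r k powr (1 - 1/2) \<and>
      c * r k powr (2 * (1/2)) \<le> \<phi> (x k) - \<phi> (x (Suc k))"
    using KL_exponent_tail_and_gap[OF lim sm KL] unfolding r_def by auto
  have "\<forall>\<^sub>F k in sequentially. c * r k \<le> r k - r (Suc k)"
    using ev by eventually_elim (simp add: nonneg, simp add: r_def)
  from geometric_decay[OF nonneg c this] obtain A q where A: "A > 0" and q: "0 < q" "q < 1"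
    and Aq: "\<forall>\<^sub>F k in sequentially. r k \<le> A * q ^ k" by blast
  have "\<forall>\<^sub>F k in sequentially. (\<Sum>j. norm (x (Suc (k + j)) - x (k + j))) \<le> (B * sqrt A) * sqrt q ^ k"
    using ev Aq
  proof eventually_elim
    case (elim k)
    have "sqrt (r k) \<le> sqrt (A * q ^ k)" using elim by simp
    also have "\<dots> = sqrt A * sqrt q ^ k" by (simp add: real_sqrt_mult real_sqrt_power)
    finally have "B * sqrt (r k) \<le> B * (sqrt A * sqrt q ^ k)" using B by simp
    then show ?case using elim nonneg[of k] by (simp add: powr_half_sqrt mult.assoc)
  qed
  then show ?thesis using A B q by (intro exI[of _ "B * sqrt A"] conjI exI[of _ "sqrt q"]) auto
qed

text \<open>With \<open>p = 2 * \<theta> - 1\<close> the gap decays like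
  \<open>k powr (- 1 / p)\<close>, and the tail is bounded by its power
  \<open>1 - \<theta>\<close>.\<close>

lemma KL_exponent_gt_half_rate:
  assumes lim: "x \<longlonglongrightarrow> xbar" and sm: "summable (\<lambda>k. norm (x (Suc k) - x k))"
    and KL: "KL_exponent_at \<theta> \<phi> xbar" and \<theta>: "1/2 < \<theta>" "\<theta> < 1"
  shows "\<exists>\<gamma>>0. \<forall>k\<ge>1. (\<Sum>j. norm (x (Suc (k + j)) - x (k + j)))
    \<le> \<gamma> * real k powr ((1 - \<theta>) / (1 - 2 * \<theta>))"
proof -
  have \<rho>: "strict_mono (\<lambda>k::nat. k)" "(x \<circ> (\<lambda>k. k)) \<longlonglongrightarrow> xbar"
    using lim by (auto simp: strict_mono_def comp_def)
  define r where "r k = \<phi> (x k) - \<phi> xbar" for k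
  have nonneg: "r k \<ge> 0" for k using phi_cluster_le[OF \<rho>, of k] by (simp add: r_def)
  obtain B c where B: "0 < B" and c: "0 < c"
    and ev: "\<forall>\<^sub>F k in sequentially. (\<Sum>j. norm (x (Suc (k + j)) - x (k + j))) \<le> B * r k powr (1 - \<theta>) \<and>
      c * r k powr (2 * \<theta>) \<le> \<phi> (x k) - \<phi> (x (Suc k))"
    using KL_exponent_tail_and_gap[OF lim sm KL] \<theta> unfolding r_def by auto
  define p where "p = 2 * \<theta> - 1"
  have p: "p > 0" using \<theta> by (simp add: p_def)
  have "\<forall>\<^sub>F k in sequentially. c * r k powr (1 + p) \<le> r k - r (Suc k)"
    using ev by eventually_elim (simp add: p_def, simp add: r_def)
  from sublinear_decay[OF nonneg c p this] obtain A where A: "A > 0"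
    and Ak: "\<forall>\<^sub>F k in sequentially. r k \<le> A * real k powr (- 1 / p)" by blast
  have exponent: "(- 1 / p) * (1 - \<theta>) = (1 - \<theta>) / (1 - 2 * \<theta>)"
    using \<theta> by (simp add: p_def field_simps)
  have "\<forall>\<^sub>F k in sequentially. (\<Sum>j. norm (x (Suc (k + j)) - x (k + j)))
      \<le> (B * A powr (1 - \<theta>)) * real k powr ((1 - \<theta>) / (1 - 2 * \<theta>))"
    using ev Ak
  proof eventually_elim
    case (elim k)
    have "r k powr (1 - \<theta>) \<le> (A * real k powr (- 1 / p)) powr (1 - \<theta>)"
      using elim nonneg[of k] \<theta> by (intro powr_mono2) auto
    also have "\<dots> = A powr (1 - \<theta>) * real k powr ((1 - \<theta>) / (1 - 2 * \<theta>))"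
      using A by (simp only: powr_mult powr_powr exponent)
    finally have "B * r k powr (1 - \<theta>) \<le> B * (A powr (1 - \<theta>) * real k powr ((1 - \<theta>) / (1 - 2 * \<theta>)))"
      using B by simp
    then show ?case using elim by (simp add: mult.assoc)
  qed
  then show ?thesis
    using A B by (intro ex_bound_if_eventually_bound[where \<gamma> = "B * A powr (1 - \<theta>)"]) auto
qed

end

section \<open>Assembly of the convergence statements\<close>

lemma KL_function_exponent_imp_KL_function: "KL_function_exponent \<theta> \<phi> \<Longrightarrow> KL_function \<phi>"
  unfolding KL_function_exponent_def KL_function_def KL_exponent_at_def KL_at_def by blast

theorem theorem10:
  fixes \<phi> :: "real ^ 'n \<Rightarrow> real" and x\<^sub>0 :: "real ^ 'n" and \<sigma>\<^sub>1 \<sigma>\<^sub>2 \<tau>max :: real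
  assumes "class_C11 \<phi>"
    and "0 < \<sigma>\<^sub>1" and "\<sigma>\<^sub>1 < \<sigma>\<^sub>2" and "\<sigma>\<^sub>2 < 1"
    and "bounded {x. \<phi> x \<le> \<phi> x\<^sub>0}"
  shows
    "(\<forall>m>0. \<exists>M\<^sub>0. \<forall>M. m < M \<and> M\<^sub>0 \<le> M \<longrightarrow>
        grnm_well_defined \<phi> \<sigma>\<^sub>1 \<sigma>\<^sub>2 m M \<tau>max x\<^sub>0) \<and>
     (\<forall>m M x. 0 < m \<and> m < M \<and> grnm_generated \<phi> \<sigma>\<^sub>1 \<sigma>\<^sub>2 m M \<tau>max x\<^sub>0 x \<longrightarrow>
        (KL_function \<phi> \<longrightarrow>
           summable (\<lambda>k. norm (x (Suc k) - x k)) \<and>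
           (\<exists>xbar. x \<longlonglongrightarrow> xbar \<and> grad \<phi> xbar = 0)) \<and>
        (\<forall>\<theta>. 0 < \<theta> \<and> \<theta> < 1 \<and> KL_function_exponent \<theta> \<phi> \<longrightarrow>
           (\<exists>xbar. x \<longlonglongrightarrow> xbar \<and> grad \<phi> xbar = 0 \<and>
              (\<theta> < 1/2 \<longrightarrow>
                 (\<forall>\<epsilon>>0. \<forall>\<^sub>F k in sequentially.
                    norm (x (Suc k) - xbar) \<le> \<epsilon> * norm (x k - xbar) powr (1 / (2 * \<theta>))) \<and>
                 (\<forall>f. class_C11 f \<and> local_minimizer f xbar \<longrightarrow> \<not> KL_exponent_at \<theta> f xbar)) \<and>
              (\<theta> = 1/2 \<longrightarrow>
                 (\<exists>\<gamma>>0. \<exists>q. 0 < q \<and> q < 1 \<and>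
                    (\<forall>\<^sub>F k in sequentially.
                       norm (x k - xbar) \<le> (\<Sum>j. norm (x (Suc (k + j)) - x (k + j))) \<and>
                       (\<Sum>j. norm (x (Suc (k + j)) - x (k + j))) \<le> \<gamma> * q ^ k))) \<and>
              (1/2 < \<theta> \<longrightarrow>
                 (\<exists>\<gamma>>0. \<forall>k\<ge>1.
                    norm (x k - xbar) \<le> (\<Sum>j. norm (x (Suc (k + j)) - x (k + j))) \<and>
                    (\<Sum>j. norm (x (Suc (k + j)) - x (k + j)))
                      \<le> \<gamma> * real k powr ((1 - \<theta>) / (1 - 2 * \<theta>)))))))"
proof (intro conjI allI impI)
  fix m :: real assume "0 < m"
  then show "\<exists>M\<^sub>0. \<forall>M. m < M \<and> M\<^sub>0 \<le> M \<longrightarrow> grnm_well_defined \<phi> \<sigma>\<^sub>1 \<sigma>\<^sub>2 m M \<tau>max x\<^sub>0"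
    using assms by (intro ex_grnm_well_defined)
next
  fix m M x assume gen: "0 < m \<and> m < M \<and> grnm_generated \<phi> \<sigma>\<^sub>1 \<sigma>\<^sub>2 m M \<tau>max x\<^sub>0 x"
  then obtain a b where ab: "0 < a" "0 < b"
    "\<And>k. a * (norm (x (Suc k) - x k))\<^sup>2 \<le> \<phi> (x k) - \<phi> (x (Suc k))"
    "\<And>k. norm (grad \<phi> (x k)) \<le> b * norm (x (Suc k) - x k)"
    using grnm_steps_decrease_and_error_bound[OF assms(1,2,4,5)] by metis
  interpret descent_sequence \<phi> x a b
    using ab assms(1) class_C11_continuous_on by unfold_locales (auto simp: class_C11_def)
  have "range x \<subseteq> {x. \<phi> x \<le> \<phi> x\<^sub>0}"
    using decseqD[OF decseq_phi, of 0] gen by (auto simp: grnm_generated_def)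
  then have bounded: "bounded (range x)" using assms(5) bounded_subset by blast
  note convergence = KL_convergence[OF bounded]
  show "summable (\<lambda>k. norm (x (Suc k) - x k))" "\<exists>xbar. x \<longlonglongrightarrow> xbar \<and> grad \<phi> xbar = 0"
    if "KL_function \<phi>"
    using convergence[OF that] by auto
  fix \<theta> assume \<theta>: "0 < \<theta> \<and> \<theta> < 1 \<and> KL_function_exponent \<theta> \<phi>"
  then have "KL_function \<phi>" using KL_function_exponent_imp_KL_function by blast
  note conv = convergence[OF this]
  from conv obtain xbar where xbar: "x \<longlonglongrightarrow> xbar" "grad \<phi> xbar = 0" by auto
  from conv have sm: "summable (\<lambda>k. norm (x (Suc k) - x k))" ..
  have KL: "KL_exponent_at \<theta> \<phi> xbar" using \<theta> by (simp add: KL_function_exponent_def)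
  have not_lt: "\<not> \<theta> < 1/2" using \<theta> not_KL_function_exponent_lt_half[OF assms(1,5)] by blast
  note tail = norm_diff_limit_le_tail[OF xbar(1) sm]
  show "\<exists>xbar. x \<longlonglongrightarrow> xbar \<and> grad \<phi> xbar = 0 \<and>
    (\<theta> < 1/2 \<longrightarrow>
       (\<forall>\<epsilon>>0. \<forall>\<^sub>F k in sequentially.
          norm (x (Suc k) - xbar) \<le> \<epsilon> * norm (x k - xbar) powr (1 / (2 * \<theta>))) \<and>
       (\<forall>f. class_C11 f \<and> local_minimizer f xbar \<longrightarrow> \<not> KL_exponent_at \<theta> f xbar)) \<and>
    (\<theta> = 1/2 \<longrightarrow>
       (\<exists>\<gamma>>0. \<exists>q. 0 < q \<and> q < 1 \<and>
          (\<forall>\<^sub>F k in sequentially.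
             norm (x k - xbar) \<le> (\<Sum>j. norm (x (Suc (k + j)) - x (k + j))) \<and>
             (\<Sum>j. norm (x (Suc (k + j)) - x (k + j))) \<le> \<gamma> * q ^ k))) \<and>
    (1/2 < \<theta> \<longrightarrow>
       (\<exists>\<gamma>>0. \<forall>k\<ge>1.
          norm (x k - xbar) \<le> (\<Sum>j. norm (x (Suc (k + j)) - x (k + j))) \<and>
          (\<Sum>j. norm (x (Suc (k + j)) - x (k + j)))
            \<le> \<gamma> * real k powr ((1 - \<theta>) / (1 - 2 * \<theta>))))"
  proof (rule exI[of _ xbar], intro conjI[OF xbar(1)] conjI[OF xbar(2)] conjI impI)
    assume "\<theta> = 1/2"
    with KL have "KL_exponent_at (1/2) \<phi> xbar" by simp
    from KL_exponent_half_rate[OF xbar(1) sm this] show "\<exists>\<gamma>>0. \<exists>q. 0 < q \<and> q < 1 \<and>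
          (\<forall>\<^sub>F k in sequentially.
             norm (x k - xbar) \<le> (\<Sum>j. norm (x (Suc (k + j)) - x (k + j))) \<and>
             (\<Sum>j. norm (x (Suc (k + j)) - x (k + j))) \<le> \<gamma> * q ^ k)"
      using tail by simp
  next
    assume "1/2 < \<theta>"
    then show "\<exists>\<gamma>>0. \<forall>k\<ge>1.
          norm (x k - xbar) \<le> (\<Sum>j. norm (x (Suc (k + j)) - x (k + j))) \<and>
          (\<Sum>j. norm (x (Suc (k + j)) - x (k + j)))
            \<le> \<gamma> * real k powr ((1 - \<theta>) / (1 - 2 * \<theta>))"
      using KL_exponent_gt_half_rate[OF xbar(1) sm KL] \<theta> tail by simp
  \<comment> \<open>Both claims for \<open>\<theta> < 1/2\<close> follow by contradiction, since the
    bounded level set excludes such an exponent.\<close>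
  qed (use not_lt in auto)
qed

end
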